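(* Let $r\in\mathbb N$ and let $k_2$ be an integer with $0<k_2<r-2$ (so $r\ge 4$). Let $x\in L^r_{\infty,\infty}(\mathbb R)$, and let $a,b,\lambda>0$ be numbers such that the function $\Psi_{a,b,\lambda}(t)=b\,\psi_r(a;\lambda t)$ satisfies $$\|x^{(s)}\|\le\|\Psi^{(s)}_{a,b,\lambda}\|,\qquad s\in\{0,\,r-2,\,r\}.$$ If points $\tau,\xi\in\mathbb R$ are such that $x(\tau)=\Psi_{a,b,\lambda}(\xi)$, then $$|x'(\tau)|\le|\Psi'_{a,b,\lambda}(\xi)|.$$
   Context: Throughout, $\|\cdot\|$ is the norm of $L_\infty(\mathbb R)$ (essential supremum of the absolute value over $\mathbb R$). For $r\in\mathbb N$, $L^r_\infty(\mathbb R)$ is the space of functions $x:\mathbb R\to\mathbb R$ such that $x^{(r-1)}$ (with $x^{(0)}=x$) exists and is locally absolutely continuous and $x^{(r)}\in L_\infty(\mathbb R)$; $L^r_{\infty,\infty}(\mathbb R):=L^r_\infty(\mathbb R)\cap L_\infty(\mathbb R)$. Comparison splines: for $a\geq 0$ define $\psi_1(a;t)$ on $[0,a+2]$ by $\psi_1(a;t)=t-1$ for $t\in[0,1]$, $\psi_1(a;t)=0$ for $t\in[1,a+1]$, $\psi_1(a;t)=t-a-1$ for $t\in[a+1,a+2]$; extend it evenly to $[-(a+2),0]$ and then periodically with period $4+2a$ to $\mathbb R$. For $r\in\mathbb N$, $\psi_r(a;\cdot)$ is the $(r-1)$-th $(4+2a)$-periodic integral of $\psi_1(a;\cdot)$ with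 zero mean value over the period (so $\psi_r'(a;t)=\psi_{r-1}(a;t)$ for $r\ge2$ and each $\psi_r(a;\cdot)$ is $(4+2a)$-periodic with zero mean). For parameters $a,b,\lambda$ put $\Psi_{a,b,\lambda}(t):=b\,\psi_r(a;\lambda t)$. *)

theory Defs
  imports "HOL-Analysis.Analysis" "HOL-Probability.Essential_Supremum"
begin

section \<open>Function classes on the real line\<close>

text \<open>The supremum norm is taken in the extended reals, so that it is defined for every function
  (it is infinite for functions that are unbounded or not measurable).\<close>

definition Linf_norm :: "(real \<Rightarrow> real) \<Rightarrow> ereal" where
  "Linf_norm f = esssup lebesgue (\<lambda>t. ereal \<bar>f t\<bar>)"

definition Linf :: "(real \<Rightarrow> real) set" where
  "Linf = {f. f \<in> borel_measurable lebesgue \<and> Linf_norm f < \<infinity>}"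

definition abs_continuous_on_interval :: "(real \<Rightarrow> real) \<Rightarrow> real \<Rightarrow> real \<Rightarrow> bool" where
  "abs_continuous_on_interval f c d \<longleftrightarrow>
    (\<forall>\<epsilon>>0. \<exists>\<delta>>0. \<forall>(n::nat) (u::nat \<Rightarrow> real) (v::nat \<Rightarrow> real).
      (\<forall>i<n. c \<le> u i \<and> u i \<le> v i \<and> v i \<le> d) \<and>
      disjoint_family_on (\<lambda>i. {u i<..<v i}) {..<n} \<and>
      (\<Sum>i<n. v i - u i) < \<delta>
      \<longrightarrow> (\<Sum>i<n. \<bar>f (v i) - f (u i)\<bar>) < \<epsilon>)"

definition locally_abs_continuous :: "(real \<Rightarrow> real) \<Rightarrow> bool" where
  "locally_abs_continuous f \<longleftrightarrow> (\<forall>c d. abs_continuous_on_interval f c d)"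

text \<open>For \<open>x\<close> in the class below, the derivative of order \<open>r\<close> exists only almost everywhere.
  On the remaining null set \<^const>\<open>deriv\<close> has an arbitrary value, which affects neither
  \<^term>\<open>Linf\<close> nor \<^term>\<open>Linf_norm\<close>. The class is only meant for \<open>r \<ge> 1\<close>.\<close>

definition Lr_inf :: "nat \<Rightarrow> (real \<Rightarrow> real) set" where
  "Lr_inf r = {x. (\<forall>k<r - 1. \<forall>t. (deriv ^^ k) x field_differentiable (at t)) \<and>
                  locally_abs_continuous ((deriv ^^ (r - 1)) x) \<and>
                  (deriv ^^ r) x \<in> Linf}"

definition Lr_inf_inf :: "nat \<Rightarrow> (real \<Rightarrow> real) set" where
  "Lr_inf_inf r = Lr_inf r \<inter> Linf"


section \<open>Comparison splines\<close>

definition psi1_base :: "real \<Rightarrow> real \<Rightarrow> real" where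
  "psi1_base a t = (if t \<le> 1 then t - 1 else if t \<le> a + 1 then 0 else t - a - 1)"

text \<open>The even \<open>(4 + 2 a)\<close>-periodic extension of \<^term>\<open>psi1_base a\<close> from \<open>[0, a + 2]\<close>:
  reduce \<open>t\<close> to \<open>[-(a + 2), a + 2]\<close> by subtracting the nearest multiple of the period, then
  take the absolute value.\<close>

definition psi1 :: "real \<Rightarrow> real \<Rightarrow> real" where
  "psi1 a t = psi1_base a \<bar>t - (4 + 2*a) * of_int (round (t / (4 + 2*a)))\<bar>"

text \<open>The antiderivative with mean value zero over \<open>[0, P]\<close>. It is \<open>P\<close>-periodic
  if \<open>f\<close> is \<open>P\<close>-periodic with mean value zero.\<close>

definition zero_mean_integral :: "real \<Rightarrow> (real \<Rightarrow> real) \<Rightarrow> real \<Rightarrow> real" where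
  "zero_mean_integral P f t =
     (LBINT u=0..ereal t. f u) - (LBINT s=0..ereal P. (LBINT u=0..ereal s. f u)) / P"

definition psi :: "nat \<Rightarrow> real \<Rightarrow> real \<Rightarrow> real" where
  "psi r a = (zero_mean_integral (4 + 2*a) ^^ (r - 1)) (psi1 a)"

definition Psi :: "nat \<Rightarrow> real \<Rightarrow> real \<Rightarrow> real \<Rightarrow> real \<Rightarrow> real" where
  "Psi r a b l t = b * psi r a (l * t)"


section \<open>The splines have the properties that characterise them\<close>

lemma psi1_eq_base:
  assumes a: "a \<ge> 0" and m: "\<bar>t - (4 + 2*a) * of_int m\<bar> \<le> a + 2"
  shows "psi1 a t = psi1_base a \<bar>t - (4 + 2*a) * of_int m\<bar>"
proof -
  define P where "P = 4 + 2*a"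
  define n where "n = round (t / P)"
  have P: "P > 0" and P2: "a + 2 = P / 2" using a by (auto simp: P_def)
  have "\<bar>of_int n - t / P\<bar> \<le> 1/2" unfolding n_def by (rule of_int_round_abs_le)
  hence "\<bar>of_int n - t / P\<bar> * P \<le> 1/2 * P" using P by (intro mult_right_mono) auto
  moreover have "\<bar>of_int n - t / P\<bar> * P = \<bar>(of_int n - t / P) * P\<bar>"
    using P by (simp add: abs_mult)
  moreover have "(of_int n - t / P) * P = P * of_int n - t" using P by (simp add: field_simps)
  ultimately have n: "\<bar>t - P * of_int n\<bar> \<le> P / 2" by (simp add: abs_minus_commute)
  have "\<bar>t - P * of_int n\<bar> = \<bar>t - P * of_int m\<bar>"
  proof (cases "m = n")
    case False
    have "P * 1 \<le> P * \<bar>of_int (m - n)\<bar>"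
      using False P by (intro mult_left_mono) linarith+
    also have "\<dots> = \<bar>P * of_int (m - n)\<bar>" using P by (simp add: abs_mult)
    also have "P * of_int (m - n) = P * of_int m - P * of_int n" by (simp add: algebra_simps)
    finally have "P \<le> \<bar>P * of_int m - P * of_int n\<bar>" by simp
    thus ?thesis using n m P2 unfolding P_def[symmetric] by linarith
  qed auto
  thus ?thesis unfolding psi1_def P_def[symmetric] n_def[symmetric] by simp
qed

lemma psi1_eq_near:
  assumes a: "a \<ge> 0"
  obtains m where "\<bar>t - (4 + 2*a) * of_int m\<bar> \<le> a + 2"
    "psi1 a t = psi1_base a \<bar>t - (4 + 2*a) * of_int m\<bar>"
proof -
  define P where "P = 4 + 2*a"
  have P: "P > 0" and P2: "a + 2 = P / 2" using a by (auto simp: P_def)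
  define n where "n = round (t / P)"
  have "\<bar>of_int n - t / P\<bar> \<le> 1/2" unfolding n_def by (rule of_int_round_abs_le)
  hence "\<bar>of_int n - t / P\<bar> * P \<le> 1/2 * P" using P by (intro mult_right_mono) auto
  moreover have "\<bar>of_int n - t / P\<bar> * P = \<bar>(of_int n - t / P) * P\<bar>"
    using P by (simp add: abs_mult)
  moreover have "(of_int n - t / P) * P = P * of_int n - t" using P by (simp add: field_simps)
  ultimately have n: "\<bar>t - (4 + 2*a) * of_int n\<bar> \<le> a + 2"
    by (simp add: abs_minus_commute P_def)
  show thesis by (rule that[OF n psi1_eq_base[OF a n]])
qed

lemma psi1_values:
  assumes "a \<ge> 0"
  shows "t \<in> {0..1} \<Longrightarrow> psi1 a t = t - 1"
    and "t \<in> {1..a+1} \<Longrightarrow> psi1 a t = 0"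
    and "t \<in> {a+1..a+2} \<Longrightarrow> psi1 a t = t - a - 1"
  using psi1_eq_base[OF assms, of t 0] assms by (auto simp: psi1_base_def)

lemma psi1_even:
  assumes "a \<ge> 0" shows "psi1 a (-t) = psi1 a t"
proof -
  obtain m where m: "\<bar>t - (4 + 2*a) * of_int m\<bar> \<le> a + 2"
    "psi1 a t = psi1_base a \<bar>t - (4 + 2*a) * of_int m\<bar>" by (rule psi1_eq_near[OF assms])
  have "\<bar>-t - (4 + 2*a) * of_int (-m)\<bar> = \<bar>t - (4 + 2*a) * of_int m\<bar>" by simp
  with m psi1_eq_base[OF assms, of "-t" "-m"] show ?thesis by simp
qed

lemma psi1_periodic:
  assumes "a \<ge> 0" shows "psi1 a (t + (4 + 2*a)) = psi1 a t"
proof -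
  obtain m where m: "\<bar>t - (4 + 2*a) * of_int m\<bar> \<le> a + 2"
    "psi1 a t = psi1_base a \<bar>t - (4 + 2*a) * of_int m\<bar>" by (rule psi1_eq_near[OF assms])
  have "t + (4 + 2*a) - (4 + 2*a) * of_int (m + 1) = t - (4 + 2*a) * of_int m"
    by (simp add: algebra_simps)
  thus ?thesis using m psi1_eq_base[OF assms, of "t + (4 + 2*a)" "m + 1"] by metis
qed

lemma psi1_half_period:
  assumes "a \<ge> 0" "t \<in> {0..a+2}" shows "psi1 a (t + (a + 2)) = - psi1 a t"
proof -
  have "psi1 a (t + (a + 2)) = psi1_base a (a + 2 - t)"
    using psi1_eq_base[of a "t + (a+2)" 1] assms by (simp add: algebra_simps)
  moreover have "psi1 a t = psi1_base a \<bar>t\<bar>"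
    using psi1_eq_base[of a t 0] assms by simp
  ultimately show ?thesis using assms by (auto simp: psi1_base_def)
qed

lemma psi1_continuous:
  assumes a: "a \<ge> 0" shows "continuous_on UNIV (psi1 a)"
proof -
  define P where "P = 4 + 2*a"
  have P: "P > 0" using a by (auto simp: P_def)
  define g where "g = (\<lambda>t. \<bar>t - P * of_int (round (t / P))\<bar>)"
  have g_le: "g t \<le> \<bar>t - P * of_int m\<bar>" for t m
  proof -
    have "\<bar>t / P - of_int (round (t / P))\<bar> * P \<le> \<bar>t / P - of_int m\<bar> * P"
      using P by (intro mult_right_mono round_diff_minimal) auto
    moreover have "\<bar>t / P - of_int k\<bar> * P = \<bar>t - P * of_int k\<bar>" for k
    proof -
      have "\<bar>t / P - of_int k\<bar> * P = \<bar>(t / P - of_int k) * P\<bar>"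
        using P by (simp add: abs_mult)
      also have "(t / P - of_int k) * P = t - P * of_int k" using P by (simp add: field_simps)
      finally show ?thesis .
    qed
    ultimately show ?thesis by (simp add: g_def)
  qed
  have "g t \<le> \<bar>t - s\<bar> + g s" for t s
    using g_le[of t "round (s / P)"] unfolding g_def by linarith
  hence lip: "dist (g t) (g s) \<le> dist t s" for t s
    by (smt (verit) dist_real_def)
  have "continuous_on UNIV g"
    unfolding continuous_on_iff by (metis lip le_less_trans UNIV_I)
  moreover have "psi1 a = (\<lambda>t. min (g t - 1) 0 + max (g t - a - 1) 0)"
    using a by (auto simp: psi1_def psi1_base_def g_def P_def fun_eq_iff)
  ultimately show ?thesis by (auto intro!: continuous_intros)
qed

lemma interval_integrable_continuous:
  fixes f :: "real \<Rightarrow> real"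
  assumes "continuous_on UNIV f"
  shows "interval_lebesgue_integrable lborel (ereal c) (ereal d) f"
  using assms
  by (intro interval_integrable_isCont) (auto simp: continuous_on_eq_continuous_at)

lemma LBINT_split:
  fixes f :: "real \<Rightarrow> real"
  assumes "continuous_on UNIV f"
  shows "(LBINT u=ereal c..ereal e. f u) = (LBINT u=ereal c..ereal d. f u) + (LBINT u=ereal d..ereal e. f u)"
proof (rule interval_integral_sum[symmetric])
  show "interval_lebesgue_integrable lborel (min (ereal c) (min (ereal d) (ereal e)))
     (max (ereal c) (max (ereal d) (ereal e))) f"
    using interval_integrable_continuous[OF assms, of "min c (min d e)" "max c (max d e)"]
    by (simp only: ereal_min ereal_max)
qed

lemma LBINT_has_derivative:
  fixes f :: "real \<Rightarrow> real"
  assumes f: "continuous_on UNIV f"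
  shows "((\<lambda>t. LBINT u=ereal c..ereal t. f u) has_real_derivative f t) (at t)"
proof -
  have "((\<lambda>t. LBINT u=ereal c..ereal t. f u) has_vector_derivative f t)
      (at t within {min c t - 1..max c t + 1})"
    by (rule interval_integral_FTC2) (auto intro: continuous_on_subset[OF f])
  moreover have "at t within {min c t - 1..max c t + 1} = at t"
    by (rule at_within_interior) auto
  ultimately show ?thesis by (simp add: has_real_derivative_iff_has_vector_derivative)
qed

lemma LBINT_shift:
  fixes f :: "real \<Rightarrow> real"
  assumes f: "continuous_on UNIV f"
  shows "(LBINT u=ereal c..ereal d. f (u + p)) = (LBINT u=ereal (c+p)..ereal (d+p). f u)"
proof -
  have fp: "continuous_on UNIV (\<lambda>u. f (u + p))"
    by (intro continuous_on_compose2[OF f] continuous_intros) auto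
  have "\<forall>t. ((\<lambda>t. (LBINT u=ereal c..ereal t. f (u + p)) - (LBINT u=ereal (c+p)..ereal (t+p). f u))
          has_real_derivative 0) (at t)"
  proof
    fix t
    have "((\<lambda>t. LBINT u=ereal (c+p)..ereal (t+p). f u) has_real_derivative f (t+p) * 1) (at t)"
      by (rule DERIV_chain2[OF LBINT_has_derivative[OF f]]) (auto intro!: derivative_eq_intros)
    from DERIV_diff[OF LBINT_has_derivative[OF fp, of c t] this]
    show "((\<lambda>t. (LBINT u=ereal c..ereal t. f (u + p)) - (LBINT u=ereal (c+p)..ereal (t+p). f u))
          has_real_derivative 0) (at t)" by simp
  qed
  from DERIV_isconst_all[OF this, of d c] show ?thesis by simp
qed

lemma zero_mean_integral_props:
  assumes P: "P > 0" and f: "continuous_on UNIV f"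
    and per: "\<And>t. f (t + P) = f t" and mean: "(LBINT u=0..ereal P. f u) = 0"
  shows "(zero_mean_integral P f has_real_derivative f t) (at t)"
    and "continuous_on UNIV (zero_mean_integral P f)"
    and "zero_mean_integral P f (t + P) = zero_mean_integral P f t"
    and "(LBINT u=0..ereal P. zero_mean_integral P f u) = 0"
proof -
  define F where "F = (\<lambda>t. LBINT u=0..ereal t. f u)"
  define K where "K = (LBINT s=0..ereal P. F s)"
  have Z: "zero_mean_integral P f = (\<lambda>t. F t - K / P)"
    by (simp add: zero_mean_integral_def[abs_def] F_def K_def)
  have DF: "(F has_real_derivative f t) (at t)" for t
    using LBINT_has_derivative[OF f, of 0 t] by (simp add: F_def zero_ereal_def)
  have DZ: "(zero_mean_integral P f has_real_derivative f t) (at t)" for t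
    unfolding Z using DERIV_diff[OF DF[of t] DERIV_const[of "K / P"]] by simp
  show "(zero_mean_integral P f has_real_derivative f t) (at t)" by (rule DZ)
  show "continuous_on UNIV (zero_mean_integral P f)"
    using DZ by (auto intro!: DERIV_continuous_on)
  have cF: "continuous_on UNIV F" using DF by (auto intro!: DERIV_continuous_on)
  have "F (t + P) = F t"
  proof -
    have "F (t + P) = (LBINT u=0..ereal P. f u) + (LBINT u=ereal (0+P)..ereal (t+P). f u)"
      using LBINT_split[OF f, of 0 "t+P" P] by (simp add: F_def zero_ereal_def)
    also have "(LBINT u=ereal (0+P)..ereal (t+P). f u) = F t"
      unfolding LBINT_shift[OF f, symmetric] per F_def by (simp add: zero_ereal_def)
    finally show ?thesis using mean by simp
  qed
  thus "zero_mean_integral P f (t + P) = zero_mean_integral P f t" by (simp add: Z)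
  have "(LBINT u=0..ereal P. F u - K / P) = (LBINT u=0..ereal P. F u) - (LBINT u=0..ereal P. K / P)"
    using interval_integrable_continuous[OF cF, of 0 P]
      interval_integrable_continuous[OF continuous_on_const, of 0 P "K / P"]
    by (intro interval_lebesgue_integral_diff) (auto simp: zero_ereal_def)
  also have "(LBINT u=0..ereal P. K / P) = K"
    using P interval_integral_const(2)[of 0 P "K / P"] by (simp add: zero_ereal_def)
  finally show "(LBINT u=0..ereal P. zero_mean_integral P f u) = 0" unfolding Z K_def by simp
qed

lemma psi1_mean:
  assumes a: "a \<ge> 0" shows "(LBINT u=0..ereal (4 + 2*a). psi1 a u) = 0"
proof -
  note c = psi1_continuous[OF a]
  have "(LBINT u=ereal 0..ereal (a+2). psi1 a (u + (a+2))) = (LBINT u=ereal 0..ereal (a+2). - psi1 a u)"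
    using a by (intro interval_integral_cong)
      (auto simp: einterval_def min_def max_def intro!: psi1_half_period)
  also have "\<dots> = - (LBINT u=ereal 0..ereal (a+2). psi1 a u)"
    by (rule interval_lebesgue_integral_uminus)
  finally have "(LBINT u=ereal (0+(a+2))..ereal ((a+2)+(a+2)). psi1 a u)
      = - (LBINT u=ereal 0..ereal (a+2). psi1 a u)"
    by (simp only: LBINT_shift[OF c])
  with LBINT_split[OF c, of 0 "4 + 2*a" "a+2"] show ?thesis
    by (simp add: zero_ereal_def algebra_simps)
qed

lemma psi_1: "psi 1 a = psi1 a"
  by (simp add: psi_def)

lemma psi_props:
  assumes a: "a \<ge> 0" and r: "r \<ge> 1"
  shows psi_continuous: "continuous_on UNIV (psi r a)"
    and psi_periodic: "psi r a (t + (4 + 2*a)) = psi r a t"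
    and psi_mean: "(LBINT u=0..ereal (4 + 2*a). psi r a u) = 0"
    and psi_derivative: "(psi (Suc r) a has_real_derivative psi r a t) (at t)"
proof -
  have P: "4 + 2*a > 0" using a by simp
  have succ: "psi (Suc n) a = zero_mean_integral (4 + 2*a) (psi n a)" if "n \<ge> 1" for n
    using that by (cases n) (auto simp: psi_def)
  have *: "continuous_on UNIV (psi r a) \<and> (\<forall>t. psi r a (t + (4 + 2*a)) = psi r a t) \<and>
        (LBINT u=0..ereal (4 + 2*a). psi r a u) = 0"
    using r
  proof (induction r rule: dec_induct)
    case base
    show ?case using psi1_continuous[OF a] psi1_periodic[OF a] psi1_mean[OF a]
      by (simp add: psi_1[unfolded One_nat_def])
  next
    case (step n)
    thus ?case unfolding succ[OF step(1)]
      using zero_mean_integral_props[OF P, of "psi n a"] by blast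
  qed
  show "continuous_on UNIV (psi r a)" "psi r a (t + (4 + 2*a)) = psi r a t"
    "(LBINT u=0..ereal (4 + 2*a). psi r a u) = 0" using * by auto
  show "(psi (Suc r) a has_real_derivative psi r a t) (at t)"
    unfolding succ[OF r] using zero_mean_integral_props(1)[OF P, of "psi r a"] * by blast
qed

end

theory Submission
  imports Defs
begin

text \<open>Write \<open>G\<^sub>s\<close> for the derivative of order \<open>s\<close> of the spline \<open>\<Psi>\<close>. Each \<open>G\<^sub>s\<close> looks like a cosine: it
changes sign under translation by the half period, is symmetric about its extrema, and is monotone
between them. The theorem says that the graph of \<open>x\<close>, wherever it is translated to meet the graph
of \<open>G\<^sub>0\<close>, is at most as steep as that graph. The same property makes sense for \<open>x\<^sup>(\<^sup>s\<^sup>)\<close> and \<open>G\<^sub>s\<close>, and it is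
proved by descending induction on \<open>s\<close>, starting from \<open>s = r - 2\<close> (\<open>slope_dominated_chain\<close>).

The start is an energy inequality. If \<open>\<bar>f\<bar> \<le> M\<close> and \<open>f'\<close> has Lipschitz constant \<open>K\<close>, then
\<open>(f')\<^sup>2 \<le> 2 K (M - \<bar>f\<bar>)\<close> (\<open>landau_pointwise\<close>). For \<open>G\<^sub>r\<^sub>-\<^sub>2\<close>, which consists of parabolic arcs of
curvature \<open>K\<close> and of plateaus at the heights \<open>\<plusminus> M\<close>, this is an equality.

For the step from \<open>x\<^sup>(\<^sup>s\<^sup>+\<^sup>1\<^sup>)\<close> to \<open>f = x\<^sup>(\<^sup>s\<^sup>)\<close>, suppose that \<open>f\<close> meets \<open>G\<^sub>s\<close> with a larger slope. By the
induction hypothesis \<open>f'\<close> cannot decay faster than \<open>G\<^sub>s\<^sub>+\<^sub>1\<close> does from the same height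
(\<open>slow_decay\<close>). Integrating, \<open>f\<close> rises by at least as much as \<open>G\<^sub>s\<close> rises from that height of its
slope to its maximum (\<open>overshoot\<close>), so \<open>f\<close> exceeds the maximum of \<open>G\<^sub>s\<close>. Hence the step works if
\<open>\<parallel>x\<^sup>(\<^sup>s\<^sup>)\<parallel> \<le> \<parallel>G\<^sub>s\<parallel>\<close> holds at every level \<open>s \<le> r - 2\<close>, whereas it is given only for \<open>s = 0\<close> and \<open>s = r - 2\<close>.

The missing norms come from a dilation argument (\<open>intermediate_norms_le\<close>). Stretching the spline
by a factor \<open>\<rho>\<close> while keeping its top derivative fixed multiplies \<open>\<parallel>G\<^sub>s\<parallel>\<close> by \<open>\<rho>\<^sup>r\<^sup>-\<^sup>s\<close>. Take the least
\<open>\<rho>\<close> for which all norms of \<open>x\<close> up to level \<open>r - 2\<close> are dominated. If \<open>\<rho> > 1\<close>, domination is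
strict at the levels \<open>0\<close> and \<open>r - 2\<close>. By the same integration argument, strictness at level \<open>s\<close>
forces strictness at level \<open>s + 1\<close> (\<open>strict_bound_chain\<close>), so it is strict everywhere, and \<open>\<rho>\<close> was not
least.

One point is measure-theoretic: the hypothesis on \<open>x\<^sup>(\<^sup>r\<^sup>)\<close> bounds \<^const>\<open>deriv\<close> almost everywhere,
and at points where \<open>x\<^sup>(\<^sup>r\<^sup>-\<^sup>1\<^sup>)\<close> is not differentiable this bound says nothing. To turn it into a
Lipschitz bound (\<open>abs_continuous_lipschitz\<close>), Vitali coverings are used to show that such points
cannot matter when the function is absolutely continuous.\<close>

section \<open>Absolute continuity and interval packings\<close>

definition increment :: "(real \<Rightarrow> real) \<Rightarrow> real set \<Rightarrow> real" where
  "increment f K = f (Sup K) - f (Inf K)"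

lemma increment_Icc [simp]: "u \<le> v \<Longrightarrow> increment f {u..v} = f v - f u"
  by (simp add: increment_def)

text \<open>Packings are sets of intervals rather than indexed families, so that they can be compared with
the divisions of Henstock--Kurzweil integration.\<close>

definition interval_packing :: "real \<Rightarrow> real \<Rightarrow> real set set \<Rightarrow> bool" where
  "interval_packing c d D \<longleftrightarrow> finite D \<and> (\<forall>K\<in>D. \<exists>u v. u \<le> v \<and> K = {u..v} \<and> c \<le> u \<and> v \<le> d) \<and>
     pairwise (\<lambda>K L. interior K \<inter> interior L = {}) D"

text \<open>The intervals are open around the point, which makes this set a countable intersection of open
sets, hence Borel.\<close>

definition descent_points :: "(real \<Rightarrow> real) \<Rightarrow> real \<Rightarrow> real set" where
  "descent_points f p =
     {x. \<forall>d>0. \<exists>u v. u < x \<and> x < v \<and> v - u < d \<and> f v - f u < p * (v - u)}"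

text \<open>The Vitali covering theorem in the form needed below: a fine cover by nondegenerate closed intervals
contains a finite disjoint family that misses only a set of small measure.\<close>

lemma finite_vitali_intervals:
  fixes S U :: "real set"
  assumes S: "S \<in> lmeasurable" and U: "open U" "bounded U" "S \<subseteq> U"
    and P: "\<And>x d. x \<in> S \<Longrightarrow> d > 0 \<Longrightarrow> \<exists>u v. u < v \<and> u \<le> x \<and> x \<le> v \<and> v - u < d \<and> P u v"
    and e: "e > 0"
  obtains F where "finite F" "pairwise disjnt F"
    "\<And>K. K \<in> F \<Longrightarrow> \<exists>u v. u < v \<and> K = {u..v} \<and> P u v \<and> {u..v} \<subseteq> U"
    "measure lebesgue (S - \<Union>F) < e"
proof -
  define I where "I = {(a, r). r > 0 \<and> P (a - r) (a + r) \<and> cball a r \<subseteq> U}"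
  have "\<exists>i. i \<in> I \<and> x \<in> cball (fst i) (snd i) \<and> snd i < d" if x: "x \<in> S" and d: "d > 0" for x d
  proof -
    obtain \<rho> where \<rho>: "\<rho> > 0" "ball x \<rho> \<subseteq> U"
      using U x by (meson openE subsetD)
    obtain u v where uv: "u < v" "u \<le> x" "x \<le> v" "v - u < min d \<rho>" "P u v"
      using P[OF x, of "min d \<rho>"] d \<rho> by auto
    have "cball ((u + v)/2) ((v - u)/2) \<subseteq> ball x \<rho>"
      using uv by (auto simp: dist_real_def abs_le_iff abs_less_iff field_simps)
    moreover have "(u+v)/2 - (v-u)/2 = u" "(u+v)/2 + (v-u)/2 = v" by (auto simp: field_simps)
    moreover have "x \<in> cball ((u + v)/2) ((v - u)/2)"
      using uv by (auto simp: dist_real_def abs_le_iff field_simps)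
    ultimately show ?thesis using uv \<rho> d
      by (intro exI[of _ "((u+v)/2, (v-u)/2)"]) (auto simp: I_def)
  qed
  note small = this
  obtain C where C: "countable C" "C \<subseteq> I"
     "pairwise (\<lambda>i j. disjnt (cball (fst i) (snd i)) (cball (fst j) (snd j))) C"
     "negligible (S - (\<Union>i \<in> C. cball (fst i) (snd i)))"
  proof (rule Vitali_covering_theorem_cballs[of I snd S fst])
    show "0 < snd i" if "i \<in> I" for i using that by (auto simp: I_def)
  qed (use small in blast)+
  define D where "D = (\<lambda>i. cball (fst i) (snd i)) ` C"
  have D: "countable D" "pairwise disjnt D" "negligible (S - \<Union>D)"
    using C by (auto simp: D_def pairwise_def)
  have DU: "K \<subseteq> U" if K: "K \<in> D" for K
  proof -
    obtain i where i: "i \<in> C" "K = cball (fst i) (snd i)" using K by (auto simp: D_def)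
    then have "i \<in> I" using C(2) by auto
    then show ?thesis using i by (simp add: I_def case_prod_beta)
  qed
  have Dm: "K \<in> lmeasurable" if "K \<in> D" for K using that by (auto simp: D_def)
  have Um: "U \<in> lmeasurable" using U by (simp add: lmeasurable_open)
  obtain F where F: "F \<subseteq> D" "finite F" "measure lebesgue (\<Union>D) - e < measure lebesgue (\<Union>F)"
  proof (rule measure_countable_Union_approachable[OF D(1) e Dm])
    fix D' assume "D' \<subseteq> D" "finite D'"
    then show "measure lebesgue (\<Union>D') \<le> measure lebesgue U"
      using DU Dm Um by (intro measure_mono_fmeasurable) (auto simp: subset_iff intro!: fmeasurableD)
  qed auto
  have Dl: "\<Union>D \<in> lmeasurable"
    using D(1) Dm DU Um by (intro fmeasurableI2[OF Um]) (auto intro!: sets.countable_Union dest: fmeasurableD)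
  have Fl: "\<Union>F \<in> lmeasurable" using F Dm by (auto intro!: fmeasurable.finite_Union)
  have "measure lebesgue (S - \<Union>F) \<le> measure lebesgue ((S - \<Union>D) \<union> (\<Union>D - \<Union>F))"
    using S Dl Fl by (intro measure_mono_fmeasurable) auto
  also have "\<dots> \<le> measure lebesgue (S - \<Union>D) + measure lebesgue (\<Union>D - \<Union>F)"
    using S Dl Fl by (intro measure_Un_le) auto
  also have "\<dots> = measure lebesgue (\<Union>D) - measure lebesgue (\<Union>F)"
    using D(3) F(1) measurable_measure_Diff[OF Dl, of "\<Union>F"] Fl
    by (simp add: negligible_imp_measure0 Union_mono fmeasurableD)
  also have "\<dots> < e" using F by simp
  finally have "measure lebesgue (S - \<Union>F) < e" .
  moreover have "\<exists>u v. u < v \<and> K = {u..v} \<and> P u v \<and> {u..v} \<subseteq> U" if KF: "K \<in> F" for K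
  proof -
    obtain i where i: "i \<in> C" "K = cball (fst i) (snd i)" using F(1) KF unfolding D_def by blast
    then have "i \<in> I" using C by auto
    moreover have "K \<subseteq> U" using F(1) DU KF by auto
    ultimately show ?thesis using i
      by (intro exI[of _ "fst i - snd i"] exI[of _ "fst i + snd i"])
        (auto simp: I_def cball_eq_atLeastAtMost)
  qed
  ultimately show thesis using F(2) pairwise_subset[OF D(2) F(1)] that by blast
qed

lemma abs_continuous_finite_family:
  assumes f: "abs_continuous_on_interval f c d" and e: "e > 0"
  obtains \<delta> where "\<delta> > 0"
    "\<And>D. interval_packing c d D \<Longrightarrow> (\<Sum>K\<in>D. measure lebesgue K) < \<delta> \<Longrightarrow>
       (\<Sum>K\<in>D. \<bar>increment f K\<bar>) < e"
proof -
  obtain \<delta> where \<delta>: "\<delta> > 0" and AC0: "\<forall>(n::nat) (u::nat \<Rightarrow> real) (v::nat \<Rightarrow> real).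
      (\<forall>i<n. c \<le> u i \<and> u i \<le> v i \<and> v i \<le> d) \<and>
      disjoint_family_on (\<lambda>i. {u i<..<v i}) {..<n} \<and>
      (\<Sum>i<n. v i - u i) < \<delta> \<longrightarrow> (\<Sum>i<n. \<bar>f (v i) - f (u i)\<bar>) < e"
    using f[unfolded abs_continuous_on_interval_def, rule_format, OF e] by (elim exE conjE)
  note AC = AC0[rule_format, OF conjI, OF _ conjI]
  show thesis
  proof (rule that[OF \<delta>])
    fix D assume pack: "interval_packing c d D" and len: "(\<Sum>K\<in>D. measure lebesgue K) < \<delta>"
    have fin: "finite D"
      and K: "\<And>K. K \<in> D \<Longrightarrow> \<exists>u v. u \<le> v \<and> K = {u..v} \<and> c \<le> u \<and> v \<le> d"
      and dis: "pairwise (\<lambda>K L. interior K \<inter> interior L = {}) D"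
      using pack by (auto simp: interval_packing_def)
    have K': "Inf K \<le> Sup K" "K = {Inf K..Sup K}" "c \<le> Inf K" "Sup K \<le> d" if "K \<in> D" for K
      using K[OF that] by auto
    obtain h where h: "bij_betw h {..<card D} D"
      using ex_bij_betw_nat_finite[OF fin] by (auto simp: atLeast0LessThan)
    have hD: "h i \<in> D" if "i < card D" for i using h that by (auto simp: bij_betw_def)
    have "(\<Sum>i<card D. \<bar>f (Sup (h i)) - f (Inf (h i))\<bar>) < e"
    proof (rule AC)
      show "\<forall>i<card D. c \<le> Inf (h i) \<and> Inf (h i) \<le> Sup (h i) \<and> Sup (h i) \<le> d"
        using K' hD by blast
      show "disjoint_family_on (\<lambda>i. {Inf (h i)<..<Sup (h i)}) {..<card D}"
        unfolding disjoint_family_on_def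
      proof safe
        fix i j x assume ij: "i < card D" "j < card D" "i \<noteq> j" "x \<in> {Inf (h i)<..<Sup (h i)}"
          "x \<in> {Inf (h j)<..<Sup (h j)}"
        have "h i \<noteq> h j" using h ij by (auto simp: bij_betw_def inj_on_def)
        then have "interior (h i) \<inter> interior (h j) = {}"
          using dis hD ij by (auto simp: pairwise_def)
        moreover have "interior (h i) = {Inf (h i)<..<Sup (h i)}" if "i < card D" for i
          using K'(2)[OF hD[OF that]] interior_atLeastAtMost_real by metis
        ultimately show "x \<in> {}" using ij by auto
      qed
      have "(\<Sum>i<card D. Sup (h i) - Inf (h i)) = (\<Sum>K\<in>D. Sup K - Inf K)"
        by (rule sum.reindex_bij_betw[OF h])
      also have "\<dots> = (\<Sum>K\<in>D. measure lebesgue K)"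
      proof (rule sum.cong)
        fix K assume "K \<in> D"
        then show "Sup K - Inf K = measure lebesgue K" using K by fastforce
      qed simp
      finally show "(\<Sum>i<card D. Sup (h i) - Inf (h i)) < \<delta>" using len by simp
    qed
    also have "(\<Sum>i<card D. \<bar>f (Sup (h i)) - f (Inf (h i))\<bar>) = (\<Sum>K\<in>D. \<bar>increment f K\<bar>)"
      unfolding increment_def using sum.reindex_bij_betw[OF h, of "\<lambda>K. \<bar>f (Sup K) - f (Inf K)\<bar>"] by simp
    finally show "(\<Sum>K\<in>D. \<bar>increment f K\<bar>) < e" .
  qed
qed

lemma sum_increment_division:
  assumes "a \<le> b" "q division_of {a..b}"
  shows "(\<Sum>K\<in>q. increment f K) = f b - f a"
proof -
  define p where "p = (\<lambda>K. (Inf K, K)) ` q"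
  have *: "\<exists>u v. u \<le> v \<and> K = {u..v}" if Kq: "K \<in> q" for K
  proof -
    obtain u v where "K = cbox u v" "K \<noteq> {}" by (rule cbox_division_memE[OF Kq assms(2)])
    then show ?thesis by (intro exI[of _ u] exI[of _ v]) auto
  qed
  have "p tagged_division_of {a..b}"
  proof (rule tagged_division_ofI)
    show "finite p" using division_ofD(1)[OF assms(2)] by (simp add: p_def)
    fix x K assume "(x, K) \<in> p"
    then have K: "K \<in> q" "x = Inf K" by (auto simp: p_def)
    then obtain u v where "u \<le> v" "K = {u..v}" using * by blast
    then show "x \<in> K" using K by simp
    show "\<exists>u v. K = cbox u v" using \<open>K = {u..v}\<close> by (intro exI[of _ u] exI[of _ v]) simp
    show "K \<subseteq> {a..b}" using division_ofD(2)[OF assms(2) K(1)] .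
  next
    show "interior K1 \<inter> interior K2 = {}" if "(x1, K1) \<in> p" "(x2, K2) \<in> p" "(x1, K1) \<noteq> (x2, K2)"
      for x1 K1 x2 K2
    proof (rule division_ofD(5)[OF assms(2)])
      show "K1 \<in> q" "K2 \<in> q" "K1 \<noteq> K2" using that by (auto simp: p_def)
    qed
    show "\<Union>{K. \<exists>x. (x, K) \<in> p} = {a..b}"
    proof -
      have "{K. \<exists>x. (x, K) \<in> p} = q" by (auto simp: p_def)
      then show ?thesis using division_ofD(6)[OF assms(2)] by simp
    qed
  qed
  from additive_tagged_division_1[OF assms(1) this, of f] show ?thesis
    unfolding p_def increment_def by (simp add: sum.reindex inj_on_def comp_def)
qed

lemma locally_abs_continuous_imp_continuous:
  assumes "locally_abs_continuous f" shows "continuous_on UNIV f"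
  unfolding continuous_on_iff
proof safe
  fix x e :: real assume e: "e > 0"
  have "abs_continuous_on_interval f (x - 1) (x + 1)"
    using assms by (simp add: locally_abs_continuous_def)
  then obtain \<delta> where \<delta>: "\<delta> > 0" and AC: "\<And>D. interval_packing (x - 1) (x + 1) D \<Longrightarrow>
      (\<Sum>K\<in>D. measure lebesgue K) < \<delta> \<Longrightarrow> (\<Sum>K\<in>D. \<bar>increment f K\<bar>) < e"
    using abs_continuous_finite_family[OF _ e] by blast
  show "\<exists>d>0. \<forall>y\<in>UNIV. dist y x < d \<longrightarrow> dist (f y) (f x) < e"
  proof (intro exI[of _ "min 1 \<delta>"] conjI ballI impI)
    fix y assume y: "dist y x < min 1 \<delta>"
    have "x - 1 \<le> min x y" "max x y \<le> x + 1" "min x y \<le> max x y"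
      using y by (auto simp: dist_real_def)
    then have "interval_packing (x - 1) (x + 1) {{min x y..max x y}}"
      unfolding interval_packing_def by (intro conjI ballI exI[of _ "min x y"] exI[of _ "max x y"]) auto
    moreover have "measure lebesgue {min x y..max x y} < \<delta>" using y by (auto simp: dist_real_def)
    ultimately have "\<bar>increment f {min x y..max x y}\<bar> < e"
      using AC by force
    then show "dist (f y) (f x) < e"
      by (cases "x \<le> y") (auto simp: dist_real_def min_def max_def abs_minus_commute)
  qed (use \<delta> in auto)
qed

lemma borel_descent_points: "descent_points f p \<in> sets borel"
proof -
  define W where "W n = \<Union>{{u<..<v} |u v. v - u < 1 / Suc n \<and> f v - f u < p * (v - u)}" for n
  have "descent_points f p = (\<Inter>n. W n)"
  proof (intro set_eqI iffI)
    fix x assume x: "x \<in> descent_points f p"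
    have "x \<in> W n" for n
    proof -
      have "0 < 1 / real (Suc n)" by simp
      then obtain u v where "u < x" "x < v" "v - u < 1 / Suc n" "f v - f u < p * (v - u)"
        using x unfolding descent_points_def by blast
      then show ?thesis unfolding W_def by (intro UnionI[of "{u<..<v}"]) auto
    qed
    then show "x \<in> (\<Inter>n. W n)" by blast
  next
    fix x assume x: "x \<in> (\<Inter>n. W n)"
    have "\<exists>u v. u < x \<and> x < v \<and> v - u < d \<and> f v - f u < p * (v - u)" if d: "d > 0" for d
    proof -
      obtain n where n: "inverse (real (Suc n)) < d" using reals_Archimedean[OF d] by auto
      have "x \<in> W n" using x by auto
      then obtain u v where "u < x" "x < v" "v - u < 1 / Suc n" "f v - f u < p * (v - u)"
        unfolding W_def by auto
      then show ?thesis using n by (intro exI[of _ u] exI[of _ v]) (auto simp: inverse_eq_divide)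
    qed
    then show "x \<in> descent_points f p" by (simp add: descent_points_def)
  qed
  moreover have "W n \<in> sets borel" for n unfolding W_def by (intro borel_open open_Union) auto
  ultimately show ?thesis by (simp add: sets.countable_INT)
qed

text \<open>On intervals of a Vitali family on which \<open>f\<close> decreases, \<open>f\<close> gains nothing. So the whole increase
of \<open>f\<close> happens on the gaps between them, and their total length is hardly more than the measure
of the complement of the descent points.\<close>

lemma descent_gaps:
  assumes uv: "u \<le> v" and \<eta>: "\<eta> > 0"
  obtains R where "interval_packing u v R"
    "(\<Sum>L\<in>R. measure lebesgue L) < measure lebesgue ({u..v} - descent_points f 0) + \<eta>"
    "f v - f u \<le> (\<Sum>L\<in>R. \<bar>increment f L\<bar>)"
proof -
  let ?A = "descent_points f 0"
  have A: "?A \<in> sets lebesgue" using borel_descent_points[of f 0] by simp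
  define S where "S = ?A \<inter> {u<..<v}"
  have Sm: "S \<in> lmeasurable" unfolding S_def
    by (rule bounded_set_imp_lmeasurable) (use A in auto)
  obtain F where F: "finite F" "pairwise disjnt F"
    "\<And>K. K \<in> F \<Longrightarrow> \<exists>s t. s < t \<and> K = {s..t} \<and> f t - f s < 0 \<and> {s..t} \<subseteq> {u<..<v}"
    "measure lebesgue (S - \<Union>F) < \<eta>"
  proof (rule finite_vitali_intervals[OF Sm, of "{u<..<v}" "\<lambda>s t. f t - f s < 0" \<eta>])
    show "\<exists>s t. s < t \<and> s \<le> x \<and> x \<le> t \<and> t - s < d \<and> f t - f s < 0"
      if x: "x \<in> S" and d: "d > 0" for x d
    proof -
      obtain s t where "s < x" "x < t" "t - s < d" "f t - f s < 0 * (t - s)"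
        using x d unfolding S_def descent_points_def by blast
      then show ?thesis by (intro exI[of _ s] exI[of _ t]) simp
    qed
    show "S \<subseteq> {u<..<v}" by (simp add: S_def)
    show "\<eta> > 0" by (rule \<eta>)
    show "open {u<..<v}" "bounded {u<..<v}" by simp_all
    fix F :: "real set set"
    assume "finite F" "pairwise disjnt F"
      "\<And>K. K \<in> F \<Longrightarrow> \<exists>s t. s < t \<and> K = {s..t} \<and> f t - f s < 0 \<and> {s..t} \<subseteq> {u<..<v}"
      "measure lebesgue (S - \<Union>F) < \<eta>"
    then show thesis by (rule that)
  qed
  have "F division_of \<Union>F"
  proof (rule division_ofI)
    fix K assume "K \<in> F"
    then obtain s t where "s < t" "K = {s..t}" using F(3) by blast
    then show "K \<noteq> {}" "\<exists>a b. K = cbox a b" by (auto intro!: exI[of _ s] exI[of _ t])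
  next
    fix K L assume "K \<in> F" "L \<in> F" "K \<noteq> L"
    then have "K \<inter> L = {}" using F(2) by (auto simp: pairwise_def disjnt_def)
    then show "interior K \<inter> interior L = {}" using interior_subset by blast
  qed (use F(1) in auto)
  moreover have "\<Union>F \<subseteq> cbox u v"
  proof
    fix x assume "x \<in> \<Union>F"
    then obtain K where "K \<in> F" "x \<in> K" by blast
    then have "x \<in> {u<..<v}" using F(3) by blast
    then show "x \<in> cbox u v" by simp
  qed
  ultimately obtain q where q: "F \<subseteq> q" "q division_of cbox u v"
    by (rule partial_division_extend_interval)
  then have qd: "q division_of {u..v}" by simp
  have qK: "\<exists>s t. s \<le> t \<and> K = {s..t} \<and> u \<le> s \<and> t \<le> v" if Kq: "K \<in> q" for K
  proof -
    obtain s t where st: "K = cbox s t" "K \<noteq> {}" "K \<subseteq> cbox u v"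
      by (rule cbox_division_memE[OF Kq q(2)])
    then have "s \<le> t" by simp
    then show ?thesis using st by (intro exI[of _ s] exI[of _ t]) simp
  qed
  have fq: "finite q" using division_ofD(1)[OF qd] .
  have split: "(\<Sum>L\<in>q. h L) = (\<Sum>L\<in>F. h L) + (\<Sum>L\<in>q - F. h L)" for h :: "real set \<Rightarrow> real"
    using sum.subset_diff[OF q(1) fq, of h] by simp
  have len: "increment (\<lambda>t. t) L = measure lebesgue L" if L: "L \<in> q" for L
  proof -
    obtain s t where "s \<le> t" "L = {s..t}" using qK[OF L] by blast
    then show ?thesis by simp
  qed
  have Fm: "L \<in> lmeasurable" if LF: "L \<in> F" for L
  proof -
    obtain s t where "L = {s..t}" using F(3)[OF LF] by blast
    then show ?thesis by simp
  qed
  have Um: "\<Union>F \<in> lmeasurable" using Fm F(1) by (intro fmeasurable.finite_Union) auto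
  have "(\<Sum>L\<in>q. measure lebesgue L) = (\<Sum>L\<in>q. increment (\<lambda>t. t) L)"
    by (rule sum.cong) (simp_all add: len)
  also have "\<dots> = v - u" by (rule sum_increment_division[OF uv qd])
  finally have "(\<Sum>L\<in>q. measure lebesgue L) = v - u" .
  moreover have "(\<Sum>L\<in>F. measure lebesgue L) = measure lebesgue (\<Union>F)"
    by (rule measure_Union'[symmetric]) (use F Fm in auto)
  ultimately have "(\<Sum>L\<in>q - F. measure lebesgue L) = measure lebesgue {u..v} - measure lebesgue (\<Union>F)"
    using split[of "measure lebesgue"] uv by simp
  also have "\<dots> = measure lebesgue ({u..v} - \<Union>F)"
    using measurable_measure_Diff[of "{u..v}" lebesgue "\<Union>F"] Um \<open>\<Union>F \<subseteq> cbox u v\<close>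
    by (simp add: fmeasurableD)
  finally have gaps: "(\<Sum>L\<in>q - F. measure lebesgue L) = measure lebesgue ({u..v} - \<Union>F)" .
  have Bm: "{u..v} - ?A \<in> lmeasurable" "S - \<Union>F \<in> lmeasurable" "{u, v} \<in> lmeasurable"
    using A fmeasurable_Diff[OF Sm fmeasurableD[OF Um]]
    by (simp_all add: fmeasurable_Diff negligible_imp_measurable del: insert_iff)
  have "measure lebesgue ({u..v} - \<Union>F) \<le> measure lebesgue ((({u..v} - ?A) \<union> (S - \<Union>F)) \<union> {u, v})"
  proof (rule measure_mono_fmeasurable)
    show "({u..v} - ?A) \<union> (S - \<Union>F) \<union> {u, v} \<in> lmeasurable"
      using Bm by (intro fmeasurable.Un)
    show "{u..v} - \<Union>F \<in> sets lebesgue" using Um by auto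
  qed (auto simp: S_def)
  also have "\<dots> \<le> measure lebesgue (({u..v} - ?A) \<union> (S - \<Union>F)) + measure lebesgue {u, v}"
    by (intro measure_Un_le fmeasurableD fmeasurable.Un Bm)
  also have "\<dots> \<le> measure lebesgue ({u..v} - ?A) + measure lebesgue (S - \<Union>F) + measure lebesgue {u, v}"
    by (intro add_right_mono measure_Un_le fmeasurableD Bm)
  also have "measure lebesgue {u, v} = 0"
    by (rule negligible_imp_measure0) simp
  finally have "(\<Sum>L\<in>q - F. measure lebesgue L) < measure lebesgue ({u..v} - ?A) + \<eta>"
    using F(4) gaps by simp
  moreover have "f v - f u \<le> (\<Sum>L\<in>q - F. \<bar>increment f L\<bar>)"
  proof -
    have "f v - f u = (\<Sum>L\<in>F. increment f L) + (\<Sum>L\<in>q - F. increment f L)"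
      using split[of "increment f"] sum_increment_division[OF uv qd, of f] by simp
    moreover have "(\<Sum>L\<in>F. increment f L) \<le> 0"
    proof (rule sum_nonpos)
      fix L assume "L \<in> F"
      then obtain s t where "s < t" "L = {s..t}" "f t - f s < 0" using F(3) by blast
      then show "increment f L \<le> 0" by simp
    qed
    moreover have "(\<Sum>L\<in>q - F. increment f L) \<le> (\<Sum>L\<in>q - F. \<bar>increment f L\<bar>)"
      by (rule sum_mono) simp
    ultimately show ?thesis by simp
  qed
  moreover have "interval_packing u v (q - F)"
    unfolding interval_packing_def
  proof (intro conjI ballI pairwiseI)
    show "finite (q - F)" using fq by simp
    show "\<exists>s t. s \<le> t \<and> K = {s..t} \<and> u \<le> s \<and> t \<le> v" if "K \<in> q - F" for K
      using that by (intro qK) simp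
    show "interior K \<inter> interior L = {}" if "K \<in> q - F" "L \<in> q - F" "K \<noteq> L" for K L
      using that by (intro division_ofD(5)[OF qd]) simp_all
  qed
  ultimately show thesis using that by blast
qed

text \<open>Absolute continuity makes the increase on the gaps small. The estimate is for a whole family of
intervals at once, because the smallness is not additive: treating the intervals one by one would
add up one error for each of them.\<close>

lemma small_increase_off_descent:
  assumes f: "abs_continuous_on_interval f c d" and e: "e > 0"
  obtains \<delta> where "\<delta> > 0"
    "\<And>I. finite I \<Longrightarrow> pairwise disjnt I \<Longrightarrow>
       (\<And>K. K \<in> I \<Longrightarrow> \<exists>u v. u \<le> v \<and> K = {u..v} \<and> c \<le> u \<and> v \<le> d) \<Longrightarrow>
       (\<Sum>K\<in>I. measure lebesgue (K - descent_points f 0)) < \<delta> \<Longrightarrow>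
       (\<Sum>K\<in>I. increment f K) < e"
proof -
  obtain \<delta> where \<delta>: "\<delta> > 0" and AC: "\<And>D. interval_packing c d D \<Longrightarrow>
      (\<Sum>K\<in>D. measure lebesgue K) < \<delta> \<Longrightarrow> (\<Sum>K\<in>D. \<bar>increment f K\<bar>) < e"
    using abs_continuous_finite_family[OF f e] by blast
  show thesis
  proof (rule that[OF \<delta>])
    fix I assume fin: "finite I" and dis: "pairwise disjnt I"
      and I: "\<And>K. K \<in> I \<Longrightarrow> \<exists>u v. u \<le> v \<and> K = {u..v} \<and> c \<le> u \<and> v \<le> d"
      and small: "(\<Sum>K\<in>I. measure lebesgue (K - descent_points f 0)) < \<delta>"
    define \<eta> where "\<eta> = (\<delta> - (\<Sum>K\<in>I. measure lebesgue (K - descent_points f 0))) / (real (card I) + 1)"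
    have \<eta>: "\<eta> > 0" using small by (simp add: \<eta>_def)
    have "\<eta> * real (card I) < \<eta> * (real (card I) + 1)" using \<eta> by (simp add: mult_less_cancel_left)
    also have "\<dots> = \<delta> - (\<Sum>K\<in>I. measure lebesgue (K - descent_points f 0))"
      unfolding \<eta>_def by simp
    finally have \<eta>2: "(\<Sum>K\<in>I. measure lebesgue (K - descent_points f 0)) + \<eta> * real (card I) < \<delta>"
      by simp
    have "\<exists>R. interval_packing (Inf K) (Sup K) R \<and>
        (\<Sum>L\<in>R. measure lebesgue L) < measure lebesgue (K - descent_points f 0) + \<eta> \<and>
        increment f K \<le> (\<Sum>L\<in>R. \<bar>increment f L\<bar>)" if K: "K \<in> I" for K
    proof -
      obtain u v where uv: "u \<le> v" "K = {u..v}" using I[OF K] by blast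
      show ?thesis
        by (rule descent_gaps[OF uv(1) \<eta>, of f]) (use uv in auto)
    qed
    then obtain R where R: "\<And>K. K \<in> I \<Longrightarrow> interval_packing (Inf K) (Sup K) (R K)"
        "\<And>K. K \<in> I \<Longrightarrow> (\<Sum>L\<in>R K. measure lebesgue L) < measure lebesgue (K - descent_points f 0) + \<eta>"
        "\<And>K. K \<in> I \<Longrightarrow> increment f K \<le> (\<Sum>L\<in>R K. \<bar>increment f L\<bar>)"
      by metis
    have sub: "L \<subseteq> K" "L \<noteq> {}" "\<exists>u v. u \<le> v \<and> L = {u..v} \<and> c \<le> u \<and> v \<le> d"
      if K: "K \<in> I" and L: "L \<in> R K" for K L
    proof -
      obtain u v where uv: "u \<le> v" "K = {u..v}" "c \<le> u" "v \<le> d" using I[OF K] by blast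
      then have "interval_packing u v (R K)" using R(1)[OF K] by simp
      then obtain s t where "s \<le> t" "L = {s..t}" "u \<le> s" "t \<le> v"
        using L unfolding interval_packing_def by blast
      then show "L \<subseteq> K" "L \<noteq> {}" "\<exists>u v. u \<le> v \<and> L = {u..v} \<and> c \<le> u \<and> v \<le> d"
        using uv by (auto intro!: exI[of _ s] exI[of _ t])
    qed
    have Rfin: "finite (R K)" if "K \<in> I" for K using R(1)[OF that] by (simp add: interval_packing_def)
    have dis': "K \<inter> K' = {}" if "K \<in> I" "K' \<in> I" "K \<noteq> K'" for K K'
      using dis that by (auto simp: pairwise_def disjnt_def)
    have Rdis: "R K \<inter> R K' = {}" if "K \<in> I" "K' \<in> I" "K \<noteq> K'" for K K'
    proof (rule equals0I)
      fix L assume "L \<in> R K \<inter> R K'"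
      then have "L \<subseteq> K" "L \<subseteq> K'" "L \<noteq> {}" using sub that by auto
      then show False using dis'[OF that] by auto
    qed
    have sumR: "(\<Sum>L\<in>(\<Union>K\<in>I. R K). h L) = (\<Sum>K\<in>I. \<Sum>L\<in>R K. h L)" for h :: "real set \<Rightarrow> real"
      by (rule sum.UNION_disjoint) (use fin Rfin Rdis in auto)
    have "interval_packing c d (\<Union>K\<in>I. R K)"
      unfolding interval_packing_def
    proof (intro conjI ballI pairwiseI)
      show "finite (\<Union>K\<in>I. R K)" using fin Rfin by blast
      fix L assume "L \<in> (\<Union>K\<in>I. R K)"
      then obtain K where K: "K \<in> I" "L \<in> R K" by blast
      show "\<exists>u v. u \<le> v \<and> L = {u..v} \<and> c \<le> u \<and> v \<le> d" by (rule sub(3)[OF K])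
      fix L' assume "L' \<in> (\<Union>K\<in>I. R K)" and ne: "L \<noteq> L'"
      then obtain K' where K': "K' \<in> I" "L' \<in> R K'" by blast
      show "interior L \<inter> interior L' = {}"
      proof (cases "K = K'")
        case True
        then show ?thesis using R(1)[OF K(1)] K(2) K'(2) ne
          by (simp add: interval_packing_def pairwise_def)
      next
        case False
        then have "L \<inter> L' = {}" using sub(1)[OF K] sub(1)[OF K'] dis'[OF K(1) K'(1)] by blast
        then show ?thesis using interior_subset by blast
      qed
    qed
    moreover have "(\<Sum>L\<in>(\<Union>K\<in>I. R K). measure lebesgue L) < \<delta>"
    proof -
      have "(\<Sum>L\<in>(\<Union>K\<in>I. R K). measure lebesgue L)
          \<le> (\<Sum>K\<in>I. measure lebesgue (K - descent_points f 0) + \<eta>)"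
        unfolding sumR by (intro sum_mono less_imp_le R(2))
      also have "\<dots> = (\<Sum>K\<in>I. measure lebesgue (K - descent_points f 0)) + \<eta> * real (card I)"
        by (simp add: sum.distrib)
      finally show ?thesis using \<eta>2 by simp
    qed
    ultimately have "(\<Sum>L\<in>(\<Union>K\<in>I. R K). \<bar>increment f L\<bar>) < e" by (rule AC)
    moreover have "(\<Sum>K\<in>I. increment f K) \<le> (\<Sum>L\<in>(\<Union>K\<in>I. R K). \<bar>increment f L\<bar>)"
      unfolding sumR by (intro sum_mono R(3))
    ultimately show "(\<Sum>K\<in>I. increment f K) < e" by simp
  qed
qed

lemma nonincreasing_if_descent_ae:
  assumes f: "abs_continuous_on_interval f c d" and cd: "c \<le> d"
    and ae: "negligible ({c..d} - descent_points f 0)"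
  shows "f d \<le> f c"
proof (rule field_le_epsilon)
  fix e :: real assume e: "e > 0"
  obtain \<delta> where \<delta>: "\<delta> > 0" "\<And>I. finite I \<Longrightarrow> pairwise disjnt I \<Longrightarrow>
       (\<And>K. K \<in> I \<Longrightarrow> \<exists>u v. u \<le> v \<and> K = {u..v} \<and> c \<le> u \<and> v \<le> d) \<Longrightarrow>
       (\<Sum>K\<in>I. measure lebesgue (K - descent_points f 0)) < \<delta> \<Longrightarrow>
       (\<Sum>K\<in>I. increment f K) < e"
    by (rule small_increase_off_descent[OF f e]) blast
  have "(\<Sum>K\<in>{{c..d}}. increment f K) < e"
  proof (rule \<delta>(2))
    show "(\<Sum>K\<in>{{c..d}}. measure lebesgue (K - descent_points f 0)) < \<delta>"
      using \<delta>(1) negligible_imp_measure0[OF ae] by simp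
  qed (use cd in \<open>auto intro!: exI[of _ c] exI[of _ d]\<close>)
  then show "f d \<le> f c + e" using cd by simp
qed

section \<open>Absolutely continuous functions with a one-sided bound on the derivative\<close>

lemma abs_continuous_diff_linear:
  assumes "abs_continuous_on_interval f c d"
  shows "abs_continuous_on_interval (\<lambda>t. f t - m * t) c d"
  unfolding abs_continuous_on_interval_def
proof (intro allI impI)
  fix e :: real assume e: "e > 0"
  have "e / 2 > 0" using e by simp
  then obtain \<delta> where \<delta>: "\<delta> > 0" and AC: "\<forall>(n::nat) (u::nat \<Rightarrow> real) (v::nat \<Rightarrow> real).
      (\<forall>i<n. c \<le> u i \<and> u i \<le> v i \<and> v i \<le> d) \<and>
      disjoint_family_on (\<lambda>i. {u i<..<v i}) {..<n} \<and>
      (\<Sum>i<n. v i - u i) < \<delta> \<longrightarrow> (\<Sum>i<n. \<bar>f (v i) - f (u i)\<bar>) < e / 2"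
    using assms[unfolded abs_continuous_on_interval_def] by meson
  show "\<exists>\<delta>>0. \<forall>(n::nat) (u::nat \<Rightarrow> real) (v::nat \<Rightarrow> real).
      (\<forall>i<n. c \<le> u i \<and> u i \<le> v i \<and> v i \<le> d) \<and>
      disjoint_family_on (\<lambda>i. {u i<..<v i}) {..<n} \<and>
      (\<Sum>i<n. v i - u i) < \<delta>
      \<longrightarrow> (\<Sum>i<n. \<bar>f (v i) - m * v i - (f (u i) - m * u i)\<bar>) < e"
  proof (intro exI[of _ "min \<delta> (e / (2 * (\<bar>m\<bar> + 1)))"] conjI allI impI)
    show "0 < min \<delta> (e / (2 * (\<bar>m\<bar> + 1)))" using \<delta> e by simp
    fix n :: nat and u v :: "nat \<Rightarrow> real"
    assume H: "(\<forall>i<n. c \<le> u i \<and> u i \<le> v i \<and> v i \<le> d) \<and>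
      disjoint_family_on (\<lambda>i. {u i<..<v i}) {..<n} \<and>
      (\<Sum>i<n. v i - u i) < min \<delta> (e / (2 * (\<bar>m\<bar> + 1)))"
    then have 1: "(\<Sum>i<n. \<bar>f (v i) - f (u i)\<bar>) < e / 2" using AC by simp
    have "(\<Sum>i<n. v i - u i) < e / (2 * (\<bar>m\<bar> + 1))" using H by simp
    then have "(\<bar>m\<bar> + 1) * (\<Sum>i<n. v i - u i) < e / 2"
      by (simp add: field_simps pos_less_divide_eq)
    moreover have "0 \<le> (\<Sum>i<n. v i - u i)" using H by (intro sum_nonneg) auto
    ultimately have 2: "\<bar>m\<bar> * (\<Sum>i<n. v i - u i) < e / 2" by (simp add: algebra_simps)
    have "(\<Sum>i<n. \<bar>f (v i) - m * v i - (f (u i) - m * u i)\<bar>)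
        \<le> (\<Sum>i<n. \<bar>f (v i) - f (u i)\<bar> + \<bar>m\<bar> * (v i - u i))"
    proof (rule sum_mono)
      fix i assume "i \<in> {..<n}"
      then have "u i \<le> v i" using H by auto
      then have "\<bar>m * (v i - u i)\<bar> = \<bar>m\<bar> * (v i - u i)" by (simp add: abs_mult)
      moreover have "f (v i) - m * v i - (f (u i) - m * u i) = (f (v i) - f (u i)) - m * (v i - u i)"
        by (simp add: algebra_simps)
      ultimately show "\<bar>f (v i) - m * v i - (f (u i) - m * u i)\<bar> \<le> \<bar>f (v i) - f (u i)\<bar> + \<bar>m\<bar> * (v i - u i)"
        by (metis abs_triangle_ineq4)
    qed
    also have "\<dots> = (\<Sum>i<n. \<bar>f (v i) - f (u i)\<bar>) + \<bar>m\<bar> * (\<Sum>i<n. v i - u i)"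
      by (simp add: sum.distrib sum_distrib_left)
    finally show "(\<Sum>i<n. \<bar>f (v i) - m * v i - (f (u i) - m * u i)\<bar>) < e" using 1 2 by simp
  qed
qed

lemma abs_continuous_uminus:
  "abs_continuous_on_interval f c d \<Longrightarrow> abs_continuous_on_interval (\<lambda>t. - f t) c d"
  unfolding abs_continuous_on_interval_def by (simp add: abs_minus_commute)

definition ascent_points :: "(real \<Rightarrow> real) \<Rightarrow> real \<Rightarrow> real set" where
  "ascent_points f p = descent_points (\<lambda>t. - f t) (- p)"

lemma ascent_points_iff:
  "x \<in> ascent_points f p \<longleftrightarrow> (\<forall>d>0. \<exists>u v. u < x \<and> x < v \<and> v - u < d \<and> p * (v - u) < f v - f u)"
  by (simp add: ascent_points_def descent_points_def minus_less_iff algebra_simps)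

lemma descent_points_diff_linear: "descent_points (\<lambda>t. f t - m * t) p = descent_points f (p + m)"
  by (simp add: descent_points_def algebra_simps)

lemma ascent_points_diff_linear: "ascent_points (\<lambda>t. f t - m * t) p = ascent_points f (p + m)"
  by (auto simp: ascent_points_iff algebra_simps)

text \<open>A packing by steep intervals turns positive measure into a total increment bounded from below;
both null set lemmas that follow play this against absolute continuity.\<close>

lemma steep_packing:
  assumes S: "S \<in> lmeasurable" "S \<subseteq> ascent_points f q" and U: "open U" "U \<subseteq> {c<..<d}" "S \<subseteq> U"
    and q: "q \<ge> 0"
  obtains F where "finite F" "pairwise disjnt F" "\<Union>F \<subseteq> U"
    "\<And>K. K \<in> F \<Longrightarrow> \<exists>u v. u < v \<and> K = {u..v} \<and> c \<le> u \<and> v \<le> d"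
    "q * (measure lebesgue S / 2) \<le> (\<Sum>K\<in>F. increment f K)"
proof (cases "measure lebesgue S = 0")
  case True
  show ?thesis by (rule that[of "{}"]) (use True in auto)
next
  case False
  then have m: "measure lebesgue S / 2 > 0" using measure_nonneg[of lebesgue S] by linarith
  have "bounded U" by (rule bounded_subset[OF _ U(2)]) simp
  obtain F where F: "finite F" "pairwise disjnt F"
    "\<And>K. K \<in> F \<Longrightarrow> \<exists>s t. s < t \<and> K = {s..t} \<and> q * (t - s) < f t - f s \<and> {s..t} \<subseteq> U"
    "measure lebesgue (S - \<Union>F) < measure lebesgue S / 2"
  proof (rule finite_vitali_intervals[OF S(1) U(1) \<open>bounded U\<close> U(3), of "\<lambda>s t. q * (t - s) < f t - f s" "measure lebesgue S / 2"])
    show "\<exists>s t. s < t \<and> s \<le> x \<and> x \<le> t \<and> t - s < \<delta> \<and> q * (t - s) < f t - f s"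
      if x: "x \<in> S" and \<delta>: "\<delta> > 0" for x \<delta>
    proof -
      obtain s t where "s < x" "x < t" "t - s < \<delta>" "q * (t - s) < f t - f s"
        using x \<delta> S(2) unfolding subset_iff ascent_points_iff by blast
      then show ?thesis by (intro exI[of _ s] exI[of _ t]) simp
    qed
    show "measure lebesgue S / 2 > 0" by (rule m)
    fix F :: "real set set"
    assume "finite F" "pairwise disjnt F"
      "\<And>K. K \<in> F \<Longrightarrow> \<exists>s t. s < t \<and> K = {s..t} \<and> q * (t - s) < f t - f s \<and> {s..t} \<subseteq> U"
      "measure lebesgue (S - \<Union>F) < measure lebesgue S / 2"
    then show thesis by (rule that)
  qed
  have Fm: "K \<in> lmeasurable" if KF: "K \<in> F" for K
  proof -
    obtain s t where "K = {s..t}" using F(3)[OF KF] by blast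
    then show ?thesis by simp
  qed
  have Um: "\<Union>F \<in> lmeasurable" using Fm F(1) by (intro fmeasurable.finite_Union) auto
  have FU: "\<Union>F \<subseteq> U"
  proof
    fix x assume "x \<in> \<Union>F"
    then obtain K where "K \<in> F" "x \<in> K" by blast
    then show "x \<in> U" using F(3) by blast
  qed
  have ivl: "\<exists>u v. u < v \<and> K = {u..v} \<and> c \<le> u \<and> v \<le> d" if KF: "K \<in> F" for K
  proof -
    obtain s t where st: "s < t" "K = {s..t}" "{s..t} \<subseteq> U" using F(3)[OF KF] by blast
    then have "s \<in> U" "t \<in> U" by auto
    then have "s \<in> {c<..<d}" "t \<in> {c<..<d}" using U(2) by blast+
    then show ?thesis using st by (intro exI[of _ s] exI[of _ t]) simp
  qed
  have "measure lebesgue S \<le> measure lebesgue ((S - \<Union>F) \<union> \<Union>F)"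
    using S(1) Um by (intro measure_mono_fmeasurable fmeasurable.Un fmeasurable_Diff fmeasurableD) auto
  also have "\<dots> \<le> measure lebesgue (S - \<Union>F) + measure lebesgue (\<Union>F)"
    using S(1) Um by (intro measure_Un_le fmeasurableD fmeasurable_Diff)
  also have "measure lebesgue (\<Union>F) = (\<Sum>K\<in>F. measure lebesgue K)"
    by (rule measure_Union') (use F Fm in auto)
  finally have "measure lebesgue S / 2 \<le> (\<Sum>K\<in>F. measure lebesgue K)" using F(4) by simp
  then have "q * (measure lebesgue S / 2) \<le> q * (\<Sum>K\<in>F. measure lebesgue K)"
    using q by (rule mult_left_mono)
  also have "\<dots> = (\<Sum>K\<in>F. q * measure lebesgue K)" by (rule sum_distrib_left)
  also have "\<dots> \<le> (\<Sum>K\<in>F. increment f K)"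
  proof (rule sum_mono)
    fix K assume "K \<in> F"
    then obtain s t where "s < t" "K = {s..t}" "q * (t - s) < f t - f s" using F(3) by blast
    then show "q * measure lebesgue K \<le> increment f K" by simp
  qed
  finally show ?thesis using F(1,2) FU ivl that by blast
qed

text \<open>This is the oscillation part of Lebesgue's differentiation theorem. After subtracting \<open>p t\<close>, disjoint
intervals on which the function rises at rate \<open>q - p\<close> cover at least half of the set. But these intervals consist of descent points up to small measure, so their total
increment must also be arbitrarily small.\<close>

lemma negligible_descent_Int_ascent:
  assumes f: "abs_continuous_on_interval f c d" and pq: "p < q"
  shows "negligible ({c<..<d} \<inter> descent_points f p \<inter> ascent_points f q)"
proof -
  define g where "g t = f t - p * t" for t
  have g: "abs_continuous_on_interval g c d"
    unfolding g_def by (rule abs_continuous_diff_linear[OF f])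
  define \<eta> where "\<eta> = q - p"
  have \<eta>: "\<eta> > 0" using pq by (simp add: \<eta>_def)
  let ?A = "descent_points g 0" and ?B = "ascent_points g \<eta>"
  define E where "E = {c<..<d} \<inter> ?A \<inter> ?B"
  have E_eq: "E = {c<..<d} \<inter> descent_points f p \<inter> ascent_points f q"
    unfolding E_def g_def by (simp add: descent_points_diff_linear ascent_points_diff_linear \<eta>_def)
  have A: "?A \<in> sets lebesgue" "?B \<in> sets lebesgue"
    unfolding ascent_points_def using borel_descent_points by simp_all
  have Em: "E \<in> lmeasurable"
  proof (rule bounded_set_imp_lmeasurable)
    show "bounded E" by (rule bounded_subset[of "{c<..<d}"]) (auto simp: E_def)
    show "E \<in> sets lebesgue" unfolding E_def by (intro sets.Int A) simp
  qed
  have "measure lebesgue E = 0"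
  proof (rule ccontr)
    assume "measure lebesgue E \<noteq> 0"
    then have m: "measure lebesgue E > 0" using measure_nonneg[of lebesgue E] by linarith
    define e where "e = \<eta> * (measure lebesgue E / 2)"
    have "e > 0" using m \<eta> by (simp add: e_def)
    then obtain \<delta> where \<delta>: "\<delta> > 0" "\<And>I. finite I \<Longrightarrow> pairwise disjnt I \<Longrightarrow>
       (\<And>K. K \<in> I \<Longrightarrow> \<exists>u v. u \<le> v \<and> K = {u..v} \<and> c \<le> u \<and> v \<le> d) \<Longrightarrow>
       (\<Sum>K\<in>I. measure lebesgue (K - ?A)) < \<delta> \<Longrightarrow> (\<Sum>K\<in>I. increment g K) < e"
      by (rule small_increase_off_descent[OF g]) blast
    obtain T where T: "open T" "E \<subseteq> T" "T - E \<in> lmeasurable" "emeasure lebesgue (T - E) < ennreal \<delta>"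
      by (rule sets_lebesgue_outer_open[OF fmeasurableD[OF Em] \<delta>(1)])
    have "measure lebesgue (T - E) < \<delta>"
      using T(3,4) \<delta>(1) by (simp add: emeasure_eq_measure2 fmeasurableD2 ennreal_less_iff measure_nonneg)
    (* The packing is confined to an open set that barely exceeds E, hence consists almost
       entirely of descent points. *)
    define U where "U = T \<inter> {c<..<d}"
    have U: "open U" "U \<subseteq> {c<..<d}" "E \<subseteq> U" using T by (auto simp: U_def E_def)
    obtain F where F: "finite F" "pairwise disjnt F" "\<Union>F \<subseteq> U"
      "\<And>K. K \<in> F \<Longrightarrow> \<exists>u v. u < v \<and> K = {u..v} \<and> c \<le> u \<and> v \<le> d"
      "\<eta> * (measure lebesgue E / 2) \<le> (\<Sum>K\<in>F. increment g K)"
      using steep_packing[OF Em _ U less_imp_le[OF \<eta>]] E_def by blast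
    have KA: "K - ?A \<in> lmeasurable" if KF: "K \<in> F" for K
    proof -
      obtain s t where "K = {s..t}" using F(4)[OF KF] by blast
      then show ?thesis using A by (simp add: fmeasurable_Diff)
    qed
    have "(\<Sum>K\<in>F. measure lebesgue (K - ?A)) = measure lebesgue (\<Union>K\<in>F. K - ?A)"
      by (rule measure_UNION'[symmetric])
        (use F(1,2) KA in \<open>auto simp: pairwise_def disjnt_def\<close>)
    also have "\<dots> \<le> measure lebesgue (T - E)"
    proof (rule measure_mono_fmeasurable)
      show "(\<Union>K\<in>F. K - ?A) \<subseteq> T - E" using F(3) by (auto simp: U_def E_def)
      show "(\<Union>K\<in>F. K - ?A) \<in> sets lebesgue" using F(1) KA by (intro sets.finite_UN) auto
    qed (rule T(3))
    also have "\<dots> < \<delta>" by fact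
    finally have "(\<Sum>K\<in>F. increment g K) < e"
    proof (rule \<delta>(2)[OF F(1,2), rotated])
      fix K assume "K \<in> F"
      then obtain s t where "s < t" "K = {s..t}" "c \<le> s" "t \<le> d" using F(4) by blast
      then show "\<exists>u v. u \<le> v \<and> K = {u..v} \<and> c \<le> u \<and> v \<le> d"
        by (intro exI[of _ s] exI[of _ t]) simp
    qed
    with F(5) show False by (simp add: e_def)
  qed
  then show ?thesis using Em unfolding E_eq negligible_iff_measure by simp
qed

text \<open>On a short interval the total increment of a packing is below \<open>1\<close>, whatever steepness \<open>n\<close> is
required, so a set of positive measure cannot be packed with arbitrarily steep intervals.\<close>

lemma negligible_infinite_ascent:
  assumes f: "abs_continuous_on_interval f c d"
  shows "negligible ({c<..<d} \<inter> (\<Inter>n::nat. ascent_points f n))"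
proof -
  define E where "E = {c<..<d} \<inter> (\<Inter>n::nat. ascent_points f n)"
  have A: "(\<Inter>n::nat. ascent_points f n) \<in> sets lebesgue"
    unfolding ascent_points_def using borel_descent_points by (intro sets.countable_INT) auto
  obtain \<delta> where \<delta>: "\<delta> > 0" and AC: "\<And>D. interval_packing c d D \<Longrightarrow>
      (\<Sum>K\<in>D. measure lebesgue K) < \<delta> \<Longrightarrow> (\<Sum>K\<in>D. \<bar>increment f K\<bar>) < 1"
    using abs_continuous_finite_family[OF f zero_less_one] by blast
  have local: "negligible (E \<inter> {s<..<s + \<delta> / 2})" for s
  proof -
    define S where "S = E \<inter> {s<..<s + \<delta> / 2}"
    have Sm: "S \<in> lmeasurable"
    proof (rule bounded_set_imp_lmeasurable)
      show "bounded S" by (rule bounded_subset[of "{c<..<d}"]) (auto simp: S_def E_def)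
      show "S \<in> sets lebesgue" unfolding S_def E_def by (intro sets.Int A) simp_all
    qed
    define U where "U = {c<..<d} \<inter> {s<..<s + \<delta> / 2}"
    have U: "open U" "U \<subseteq> {c<..<d}" "S \<subseteq> U" by (auto simp: U_def S_def E_def)
    have bound: "real n * (measure lebesgue S / 2) < 1" for n
    proof -
      obtain F where F: "finite F" "pairwise disjnt F" "\<Union>F \<subseteq> U"
        "\<And>K. K \<in> F \<Longrightarrow> \<exists>u v. u < v \<and> K = {u..v} \<and> c \<le> u \<and> v \<le> d"
        "real n * (measure lebesgue S / 2) \<le> (\<Sum>K\<in>F. increment f K)"
      proof -
        have "S \<subseteq> ascent_points f (real n)" by (auto simp: S_def E_def)
        from steep_packing[OF Sm this U of_nat_0_le_iff] show thesis using that by blast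
      qed
      have Fm: "K \<in> lmeasurable" if KF: "K \<in> F" for K
      proof -
        obtain s t where "K = {s..t}" using F(4)[OF KF] by blast
        then show ?thesis by simp
      qed
      have "interval_packing c d F" unfolding interval_packing_def
      proof (intro conjI ballI pairwiseI)
        fix K assume "K \<in> F"
        then obtain s t where "s < t" "K = {s..t}" "c \<le> s" "t \<le> d" using F(4) by blast
        then show "\<exists>u v. u \<le> v \<and> K = {u..v} \<and> c \<le> u \<and> v \<le> d"
          by (intro exI[of _ s] exI[of _ t]) simp
      next
        fix K L assume "K \<in> F" "L \<in> F" "K \<noteq> L"
        then have "K \<inter> L = {}" using F(2) by (auto simp: pairwise_def disjnt_def)
        then show "interior K \<inter> interior L = {}" using interior_subset by blast
      qed (rule F(1))
      moreover have "(\<Sum>K\<in>F. measure lebesgue K) < \<delta>"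
      proof -
        have "(\<Sum>K\<in>F. measure lebesgue K) = measure lebesgue (\<Union>F)"
          by (rule measure_Union'[symmetric]) (use F Fm in auto)
        also have "\<dots> \<le> measure lebesgue {s..s + \<delta> / 2}"
        proof (rule measure_mono_fmeasurable)
          show "\<Union>F \<subseteq> {s..s + \<delta> / 2}" using F(3) by (force simp: U_def)
          show "\<Union>F \<in> sets lebesgue" using F(1) Fm by (intro sets.finite_Union) auto
        qed simp
        also have "\<dots> < \<delta>" using \<delta> by simp
        finally show ?thesis .
      qed
      ultimately have "(\<Sum>K\<in>F. \<bar>increment f K\<bar>) < 1" by (rule AC)
      moreover have "(\<Sum>K\<in>F. increment f K) \<le> (\<Sum>K\<in>F. \<bar>increment f K\<bar>)" by (rule sum_mono) simp
      ultimately show ?thesis using F(5) by linarith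
    qed
    have "measure lebesgue S = 0"
    proof (rule ccontr)
      assume "measure lebesgue S \<noteq> 0"
      then have "measure lebesgue S / 2 > 0" using measure_nonneg[of lebesgue S] by linarith
      then obtain n :: nat where "1 < real n * (measure lebesgue S / 2)"
        using reals_Archimedean3 by blast
      then show False using bound[of n] by linarith
    qed
    then show ?thesis using Sm unfolding S_def negligible_iff_measure by simp
  qed
  have "negligible E"
  proof (rule locally_negligible_alt[THEN iffD2], rule ballI)
    fix x assume x: "x \<in> E"
    show "\<exists>U. openin (top_of_set E) U \<and> x \<in> U \<and> negligible U"
    proof (intro exI[of _ "E \<inter> {x - \<delta>/4<..<x - \<delta>/4 + \<delta>/2}"] conjI)
      show "openin (top_of_set E) (E \<inter> {x - \<delta>/4<..<x - \<delta>/4 + \<delta>/2})" by (rule openin_open_Int) simp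
      show "x \<in> E \<inter> {x - \<delta>/4<..<x - \<delta>/4 + \<delta>/2}" using x \<delta> by simp
    qed (rule local)
  qed
  then show ?thesis by (simp add: E_def)
qed

text \<open>Off the exceptional sets the slopes over small intervals around \<open>x\<close> converge: the limit is the
supremum of all \<open>p\<close> that eventually bound them from below. Intervals with \<open>x\<close> as an end point
are reached by continuity of \<open>f\<close>.\<close>

lemma differentiable_if_slopes_squeezed:
  assumes cont: "continuous_on UNIV f"
    and low: "x \<notin> descent_points f k" and up: "x \<notin> ascent_points f (real n)"
    and osc: "\<And>p q. p \<in> \<rat> \<Longrightarrow> q \<in> \<rat> \<Longrightarrow> p < q \<Longrightarrow> x \<in> descent_points f p \<Longrightarrow> x \<notin> ascent_points f q"
  obtains D where "D \<ge> k" "(f has_real_derivative D) (at x)"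
proof -
  have nd: "\<exists>d>0. \<forall>u v. u < x \<longrightarrow> x < v \<longrightarrow> v - u < d \<longrightarrow> p * (v - u) \<le> f v - f u"
    if "x \<notin> descent_points f p" for p
    using that unfolding descent_points_def mem_Collect_eq not_all not_imp not_ex de_Morgan_conj not_less
    by (metis not_le)
  have na: "\<exists>d>0. \<forall>u v. u < x \<longrightarrow> x < v \<longrightarrow> v - u < d \<longrightarrow> f v - f u \<le> p * (v - u)"
    if "x \<notin> ascent_points f p" for p
    using that unfolding ascent_points_iff not_all not_imp not_ex de_Morgan_conj not_less
    by (metis not_le)
  define A where "A = {p. x \<notin> descent_points f p}"
  have kA: "k \<in> A" using low by (simp add: A_def)
  have An: "p \<le> n" if "p \<in> A" for p
  proof -
    obtain d1 where d1: "d1 > 0" "\<And>u v. u < x \<Longrightarrow> x < v \<Longrightarrow> v - u < d1 \<Longrightarrow> p * (v - u) \<le> f v - f u"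
      using nd[of p] \<open>p \<in> A\<close> unfolding A_def by auto
    obtain d2 where d2: "d2 > 0" "\<And>u v::real. u < x \<Longrightarrow> x < v \<Longrightarrow> v - u < d2 \<Longrightarrow> f v - f u \<le> n * (v - u)"
      using na[OF up] by auto
    define h where "h = min d1 d2 / 4"
    have h: "h > 0" "2 * h < d1" "2 * h < d2" using d1(1) d2(1) by (auto simp: h_def)
    have "p * (2 * h) \<le> f (x + h) - f (x - h)" using d1(2)[of "x - h" "x + h"] h by simp
    also have "\<dots> \<le> n * (2 * h)" using d2(2)[of "x - h" "x + h"] h by simp
    finally show ?thesis using h by simp
  qed
  have bdd: "bdd_above A" by (rule bdd_aboveI[of _ "real n"]) (rule An)
  define s where "s = Sup A"
  have sk: "k \<le> s" unfolding s_def by (rule cSup_upper[OF kA bdd])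
  have mono: "p \<in> A" if p': "p' \<in> A" "p \<le> p'" for p p'
  proof -
    obtain d where d: "d > 0" "\<And>u v. u < x \<Longrightarrow> x < v \<Longrightarrow> v - u < d \<Longrightarrow> p' * (v - u) \<le> f v - f u"
      using nd[of p'] p'(1) unfolding A_def by auto
    have "\<not> f v - f u < p * (v - u)" if "u < x" "x < v" "v - u < d" for u v
    proof -
      have "p * (v - u) \<le> p' * (v - u)" using that \<open>p \<le> p'\<close> by (intro mult_right_mono) auto
      then show ?thesis using d(2)[OF that] by linarith
    qed
    then show ?thesis using d(1) unfolding A_def descent_points_def by blast
  qed
  have main: "\<exists>d>0. \<forall>u v. u < x \<longrightarrow> x < v \<longrightarrow> v - u < d \<longrightarrow> \<bar>f v - f u - s * (v - u)\<bar> \<le> e * (v - u)"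
    if e: "e > 0" for e
  proof -
    have "s - e < Sup A" using e by (simp add: s_def)
    then obtain p' where "p' \<in> A" "s - e < p'" using less_cSup_iff[OF _ bdd] kA by blast
    then have "s - e \<in> A" using mono[of p' "s - e"] by simp
    then obtain d1 where d1: "d1 > 0" "\<And>u v. u < x \<Longrightarrow> x < v \<Longrightarrow> v - u < d1 \<Longrightarrow> (s - e) * (v - u) \<le> f v - f u"
      using nd[of "s - e"] unfolding A_def by auto
    obtain p where p: "p \<in> \<rat>" "s < p" "p < s + e" using Rats_dense_in_real[of s "s + e"] e by auto
    obtain q where q: "q \<in> \<rat>" "p < q" "q < s + e" using Rats_dense_in_real[of p "s + e"] p by auto
    have "p \<notin> A" using cSup_upper[OF _ bdd, of p] p unfolding s_def by auto
    then have "x \<notin> ascent_points f q" using osc[of p q] p q by (simp add: A_def)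
    then obtain d2 where d2: "d2 > 0" "\<And>u v. u < x \<Longrightarrow> x < v \<Longrightarrow> v - u < d2 \<Longrightarrow> f v - f u \<le> q * (v - u)"
      using na[of q] by auto
    show ?thesis
    proof (intro exI[of _ "min d1 d2"] conjI allI impI)
      show "0 < min d1 d2" using d1 d2 by simp
      fix u v assume uv: "u < x" "x < v" "v - u < min d1 d2"
      have "(s - e) * (v - u) \<le> f v - f u" using d1(2)[of u v] uv by simp
      moreover have "f v - f u \<le> q * (v - u)" using d2(2)[of u v] uv by simp
      moreover have "q * (v - u) \<le> (s + e) * (v - u)" using q uv by (intro mult_right_mono) auto
      ultimately show "\<bar>f v - f u - s * (v - u)\<bar> \<le> e * (v - u)"
        by (simp add: abs_le_iff algebra_simps)
    qed
  qed
  have cf: "isCont f x" using cont by (simp add: continuous_on_eq_continuous_at)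
  have "(f has_derivative (\<lambda>h. s * h)) (at x)"
    unfolding has_derivative_at_alt
  proof (intro conjI allI impI)
    show "bounded_linear ((*) s)" by (rule bounded_linear_mult_right)
    fix e :: real assume e: "e > 0"
    obtain d where d: "d > 0" "\<And>u v. u < x \<Longrightarrow> x < v \<Longrightarrow> v - u < d \<Longrightarrow> \<bar>f v - f u - s * (v - u)\<bar> \<le> e * (v - u)"
      using main[OF e] by blast
    show "\<exists>d>0. \<forall>y. norm (y - x) < d \<longrightarrow> norm (f y - f x - s * (y - x)) \<le> e * norm (y - x)"
    proof (intro exI[of _ "d/2"] conjI allI impI)
      show "d / 2 > 0" using d by simp
      fix y assume y: "norm (y - x) < d / 2"
      consider "y = x" | "x < y" | "y < x" by linarith
      then show "norm (f y - f x - s * (y - x)) \<le> e * norm (y - x)"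
      proof cases
        case 2
        have lim: "((\<lambda>u. e * (y - u) - \<bar>f y - f u - s * (y - u)\<bar>) \<longlongrightarrow>
            e * (y - x) - \<bar>f y - f x - s * (y - x)\<bar>) (at_left x)"
          using cf by (intro tendsto_intros) (auto simp: isCont_def intro: tendsto_mono[OF at_le])
        have "\<forall>\<^sub>F u in at_left x. u \<in> {x - d/2<..<x}" using d by (intro eventually_at_left_real) simp
        then have "\<forall>\<^sub>F u in at_left x. 0 \<le> e * (y - u) - \<bar>f y - f u - s * (y - u)\<bar>"
          by eventually_elim (use d(2)[of _ y] y 2 in auto)
        from tendsto_lowerbound[OF lim this] 2 show ?thesis by simp
      next
        case 3
        have lim: "((\<lambda>v. e * (v - y) - \<bar>f v - f y - s * (v - y)\<bar>) \<longlongrightarrow>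
            e * (x - y) - \<bar>f x - f y - s * (x - y)\<bar>) (at_right x)"
          using cf by (intro tendsto_intros) (auto simp: isCont_def intro: tendsto_mono[OF at_le])
        have "\<forall>\<^sub>F v in at_right x. v \<in> {x<..<x + d/2}" using d by (intro eventually_at_right_real) simp
        then have "\<forall>\<^sub>F v in at_right x. 0 \<le> e * (v - y) - \<bar>f v - f y - s * (v - y)\<bar>"
          by eventually_elim (use d(2)[of y] y 3 in auto)
        from tendsto_lowerbound[OF lim this] have "\<bar>f x - f y - s * (x - y)\<bar> \<le> e * (x - y)" by simp
        moreover have "f y - f x - s * (y - x) = - (f x - f y - s * (x - y))" by (simp add: algebra_simps)
        ultimately show ?thesis using 3 by (simp add: abs_minus_commute del: minus_diff_eq)
      qed simp
    qed
  qed
  then have "(f has_real_derivative s) (at x)" by (simp add: has_field_derivative_def)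
  then show thesis using that sk by blast
qed

text \<open>If \<open>k > K\<close>, almost every point belongs to \<open>descent_points f k\<close>. Otherwise it lies in one of
the null sets above, or \<open>f\<close> is differentiable there with a derivative of at least \<open>k\<close>. The
hypothesis is phrased through existing derivatives only, so that nothing is assumed where \<open>f\<close> is
not differentiable.\<close>

lemma abs_continuous_increment_le:
  assumes f: "locally_abs_continuous f" and cd: "c \<le> d"
    and ae: "AE x in lebesgue. \<forall>D. (f has_real_derivative D) (at x) \<longrightarrow> D \<le> K"
  shows "f d - f c \<le> K * (d - c)"
proof -
  have AC: "abs_continuous_on_interval f c d" using f by (simp add: locally_abs_continuous_def)
  obtain N where N: "N \<in> null_sets lebesgue"
    and NK: "\<And>x. x \<in> space lebesgue - N \<Longrightarrow> \<forall>D. (f has_real_derivative D) (at x) \<longrightarrow> D \<le> K"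
    using AE_E3[OF ae] by blast
  define Q where "Q = {(p, q). p \<in> \<rat> \<and> q \<in> \<rat> \<and> p < (q::real)}"
  define Z where "Z = N \<union> {c, d} \<union> ({c<..<d} \<inter> (\<Inter>n::nat. ascent_points f n)) \<union>
     (\<Union>(p, q)\<in>Q. {c<..<d} \<inter> descent_points f p \<inter> ascent_points f q)"
  have "countable Q"
    by (rule countable_subset[of _ "\<rat> \<times> \<rat>"]) (auto simp: Q_def countable_rat)
  then have "negligible (\<Union>(p, q)\<in>Q. {c<..<d} \<inter> descent_points f p \<inter> ascent_points f q)"
    by (intro negligible_countable_Union) (auto simp: Q_def intro: negligible_descent_Int_ascent[OF AC])
  moreover have "negligible N" using N by (simp add: negligible_iff_null_sets)
  ultimately have Z: "negligible Z"
    unfolding Z_def using negligible_infinite_ascent[OF AC] by (intro negligible_Un) simp_all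
  have "f d - f c \<le> k * (d - c)" if k: "k > K" for k
  proof -
    define g where "g t = f t - k * t" for t
    have "{c..d} - descent_points g 0 \<subseteq> Z"
    proof
      fix x assume x: "x \<in> {c..d} - descent_points g 0"
      show "x \<in> Z"
      proof (rule ccontr)
        assume xZ: "x \<notin> Z"
        have low: "x \<notin> descent_points f k"
          using x by (simp add: g_def[abs_def] descent_points_diff_linear)
        have xcd: "x \<in> {c<..<d}" using x xZ by (auto simp: Z_def)
        then obtain n :: nat where up: "x \<notin> ascent_points f n" using xZ by (auto simp: Z_def)
        have osc: "x \<notin> ascent_points f q" if "p \<in> \<rat>" "q \<in> \<rat>" "p < q" "x \<in> descent_points f p" for p q
        proof
          assume "x \<in> ascent_points f q"
          then have "x \<in> (\<Union>(p, q)\<in>Q. {c<..<d} \<inter> descent_points f p \<inter> ascent_points f q)"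
            using that xcd by (intro UN_I[of "(p, q)"]) (auto simp: Q_def)
          then show False using xZ by (simp add: Z_def)
        qed
        obtain D where "D \<ge> k" "(f has_real_derivative D) (at x)"
          by (rule differentiable_if_slopes_squeezed[OF locally_abs_continuous_imp_continuous[OF f] low up osc])
        moreover have "x \<notin> N" using xZ by (simp add: Z_def)
        ultimately have "D \<le> K" using NK[of x] by simp
        then show False using \<open>D \<ge> k\<close> k by simp
      qed
    qed
    then have "negligible ({c..d} - descent_points g 0)" by (rule negligible_subset[OF Z])
    from nonincreasing_if_descent_ae[OF _ cd this] have "g d \<le> g c"
      using abs_continuous_diff_linear[OF AC, of k] by (simp add: g_def[abs_def])
    then show ?thesis by (simp add: g_def algebra_simps)
  qed
  note le = this
  show ?thesis
  proof (rule field_le_epsilon)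
    fix e :: real assume e: "e > 0"
    define k where "k = K + e / (d - c + 1)"
    have "f d - f c \<le> k * (d - c)" by (rule le) (use e cd in \<open>simp add: k_def\<close>)
    also have "\<dots> = K * (d - c) + e * ((d - c) / (d - c + 1))" by (simp add: k_def algebra_simps)
    also have "\<dots> \<le> K * (d - c) + e * 1"
      using e cd by (intro add_left_mono mult_left_mono) (auto simp: field_simps)
    finally show "f d - f c \<le> K * (d - c) + e" by simp
  qed
qed

lemma abs_continuous_lipschitz:
  assumes f: "locally_abs_continuous f" and ae: "AE x in lebesgue. \<bar>deriv f x\<bar> \<le> K"
  shows "\<bar>f d - f c\<bar> \<le> K * \<bar>d - c\<bar>"
proof -
  have *: "\<bar>f d - f c\<bar> \<le> K * (d - c)" if cd: "c \<le> d" for c d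
  proof -
    have "f d - f c \<le> K * (d - c)"
      by (rule abs_continuous_increment_le[OF f cd]) (use ae in \<open>eventually_elim, auto dest: DERIV_imp_deriv\<close>)
    moreover have "- f d - - f c \<le> K * (d - c)"
    proof (rule abs_continuous_increment_le[OF _ cd])
      show "locally_abs_continuous (\<lambda>x. - f x)"
        using f abs_continuous_uminus by (auto simp: locally_abs_continuous_def)
      show "AE x in lebesgue. \<forall>D. ((\<lambda>x. - f x) has_real_derivative D) (at x) \<longrightarrow> D \<le> K"
        using ae
      proof eventually_elim
        case (elim x)
        show ?case
        proof (intro allI impI)
          fix D assume "((\<lambda>x. - f x) has_real_derivative D) (at x)"
          from DERIV_imp_deriv[OF DERIV_minus[OF this]] show "D \<le> K" using elim by simp
        qed
      qed
    qed
    ultimately show ?thesis by simp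
  qed
  show ?thesis using *[of c d] *[of d c] by (cases "c \<le> d") (auto simp: abs_minus_commute)
qed

section \<open>Comparison with a cosine-like chain of functions\<close>

text \<open>Moving from \<open>t\<close> by \<open>f' t / K\<close>, the function gains at least \<open>(f' t)\<^sup>2 / (2 K)\<close>, since its slope changes at
rate at most \<open>K\<close>; this gain must not lead beyond \<open>M\<close>.\<close>

lemma landau_pointwise:
  fixes f D :: "real \<Rightarrow> real"
  assumes f: "\<And>t. (f has_real_derivative D t) (at t)"
    and D: "\<And>s t. \<bar>D t - D s\<bar> \<le> K * \<bar>t - s\<bar>" and K: "K > 0"
    and M: "\<And>t. \<bar>f t\<bar> \<le> M"
  shows "(D t)\<^sup>2 \<le> 2 * K * (M - \<bar>f t\<bar>)"
proof -
  have one_sided: "(D t)\<^sup>2 \<le> 2 * K * (M - f t)"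
    if f: "\<And>t. (f has_real_derivative D t) (at t)"
      and D: "\<And>s t. \<bar>D t - D s\<bar> \<le> K * \<bar>t - s\<bar>" and M: "\<And>t. f t \<le> M" for f D :: "real \<Rightarrow> real"
  proof -
    define \<phi> where "\<phi> s = f (t + s) - D t * s + K * s\<^sup>2 / 2" for s
    have \<phi>': "(\<phi> has_real_derivative D (t + s) - D t + K * s) (at s)" for s
      unfolding \<phi>_def[abs_def]
      by (rule derivative_eq_intros DERIV_chain2[OF f] refl | simp)+
    have "\<phi> 0 \<le> \<phi> s" for s
    proof (cases "s \<ge> 0")
      case True
      show ?thesis
      proof (rule DERIV_nonneg_imp_nondecreasing[OF True])
        fix u assume "0 \<le> u" "u \<le> s"
        then have "0 \<le> D (t + u) - D t + K * u" using D[where t = "t + u" and s = t] by auto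
        then show "\<exists>y. (\<phi> has_real_derivative y) (at u) \<and> 0 \<le> y" using \<phi>' by blast
      qed
    next
      case False
      show ?thesis
      proof (rule DERIV_nonpos_imp_nonincreasing[of s 0 \<phi>])
        fix u assume "s \<le> u" "u \<le> 0"
        then have "D (t + u) - D t + K * u \<le> 0" using D[where t = "t + u" and s = t] by auto
        then show "\<exists>y. (\<phi> has_real_derivative y) (at u) \<and> y \<le> 0" using \<phi>' by blast
      qed (use False in simp)
    qed
    from this[of "D t / K"] have "f t \<le> f (t + D t / K) - (D t)\<^sup>2 / (2 * K)"
      using K by (simp add: \<phi>_def power2_eq_square field_simps)
    with M[of "t + D t / K"] have "(D t)\<^sup>2 / (2 * K) \<le> M - f t" by linarith
    then show ?thesis using K by (simp add: field_simps)
  qed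
  have "(D t)\<^sup>2 \<le> 2 * K * (M - f t)"
    by (rule one_sided[OF f D]) (use M in \<open>simp add: abs_le_iff\<close>)
  moreover have "(- D t)\<^sup>2 \<le> 2 * K * (M - (- f t))"
  proof (rule one_sided)
    show "((\<lambda>t. - f t) has_real_derivative - D t) (at t)" for t by (rule DERIV_minus[OF f])
    show "\<bar>- D t - - D s\<bar> \<le> K * \<bar>t - s\<bar>" for s t using D[of t s] by (simp add: abs_minus_commute)
    show "- f t \<le> M" for t using M[of t] by (simp add: abs_le_iff)
  qed
  ultimately show ?thesis by (cases "f t \<ge> 0") auto
qed

text \<open>The chain abstracts from the splines what the comparison needs. Every \<open>G k\<close> is centred at a maximum,
which puts the zeros at \<open>\<plusminus> h / 2\<close> for all \<open>k\<close>. The translation by \<open>h / 2\<close> in \<open>deriv\<close> is the price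
of centring, as for the cosine, whose derivative is \<open>cos (t + \<pi> / 2)\<close>. The function \<open>G 1\<close> vanishes
outside \<open>(-w, w)\<close> within its hump and corresponds to the derivative of order \<open>r - 1\<close>.\<close>

locale comparison_chain =
  fixes G :: "nat \<Rightarrow> real \<Rightarrow> real" and h w K :: real
  assumes w: "0 < w" "w \<le> h / 2" and K: "K > 0"
    and even: "k \<ge> 1 \<Longrightarrow> G k (- t) = G k t"
    and anti: "k \<ge> 1 \<Longrightarrow> G k (t + h) = - G k t"
    and deriv: "k \<ge> 1 \<Longrightarrow> (G (Suc k) has_real_derivative G k (t + h / 2)) (at t)"
    and G1_nonneg: "\<bar>t\<bar> \<le> h / 2 \<Longrightarrow> G 1 t \<ge> 0"
    and G1_pos: "\<bar>t\<bar> < w \<Longrightarrow> G 1 t > 0"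
    and G1_zero: "w \<le> \<bar>t\<bar> \<Longrightarrow> \<bar>t\<bar> \<le> h / 2 \<Longrightarrow> G 1 t = 0"
    and G2_energy: "0 \<le> t \<Longrightarrow> t \<le> h / 2 \<Longrightarrow> (G 1 (t + h / 2))\<^sup>2 = 2 * K * (G 2 0 - G 2 t)"
begin

lemma h_pos: "h > 0" using w by simp

text \<open>The length of the half plateau around the maximum of \<open>G k\<close>; only \<open>G 2\<close> has a plateau, since
only \<open>G 1\<close> vanishes on an interval.\<close>

definition flat :: "nat \<Rightarrow> real" where
  "flat k = (if k = 2 then h / 2 - w else 0)"

lemma flat_bounds: "0 \<le> flat k" "flat k < h / 2"
  using w h_pos by (auto simp: flat_def)

lemma shift_half: "k \<ge> 1 \<Longrightarrow> G k (t + h / 2) = - G k (t - h / 2)"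
  using anti[of k "t - h / 2"] by (simp add: add.commute)

lemma deriv': "k \<ge> 1 \<Longrightarrow> (G (Suc k) has_real_derivative - G k (t - h / 2)) (at t)"
  using deriv[of k t] shift_half[of k t] by simp

lemma zero_half: "k \<ge> 1 \<Longrightarrow> G k (h / 2) = 0"
  using anti[of k "- h / 2"] even[of k "h / 2"] by simp

lemma continuous_G: "k \<ge> 2 \<Longrightarrow> continuous_on S (G k)"
  using deriv[of "k - 1"] by (intro DERIV_continuous_on[of S _ "\<lambda>t. G (k - 1) (t + h / 2)"])
    (auto simp: Suc_diff_le intro: has_field_derivative_at_within)

lemma decreasing_if_slope_nonneg:
  assumes k: "k \<ge> 1" and nn: "\<And>t. \<bar>t\<bar> \<le> h / 2 \<Longrightarrow> G k t \<ge> 0"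
    and st: "0 \<le> s" "s \<le> t" "t \<le> h"
  shows "G (Suc k) t \<le> G (Suc k) s"
proof (rule DERIV_nonpos_imp_nonincreasing[OF st(2)])
  fix u assume "s \<le> u" "u \<le> t"
  then have "G k (u - h / 2) \<ge> 0" using st by (intro nn) linarith
  then show "\<exists>y. (G (Suc k) has_real_derivative y) (at u) \<and> y \<le> 0"
    using deriv'[OF k, of u] by (intro exI[of _ "- G k (u - h / 2)"]) simp
qed

lemma pos_inside_if_slope_nonneg:
  assumes k: "k \<ge> 1" and nn: "\<And>t. \<bar>t\<bar> \<le> h / 2 \<Longrightarrow> G k t \<ge> 0"
    and pos: "\<And>t. \<bar>t\<bar> < w \<Longrightarrow> G k t > 0" and t: "\<bar>t\<bar> < h / 2"
  shows "G (Suc k) t > 0"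
proof -
  define t0 where "t0 = max \<bar>t\<bar> (h / 2 - w)"
  have t0: "0 \<le> t0" "\<bar>t\<bar> \<le> t0" "t0 < h / 2" "h / 2 - w \<le> t0" using t w by (auto simp: t0_def max_def)
  have "G (Suc k) (h / 2) < G (Suc k) t0"
  proof (rule DERIV_neg_imp_decreasing_open[OF t0(3)])
    fix u assume "t0 < u" "u < h / 2"
    then have "G k (u - h / 2) > 0" using t0 by (intro pos) auto
    then show "\<exists>y. (G (Suc k) has_real_derivative y) (at u) \<and> y < 0"
      using deriv'[OF k, of u] by (intro exI[of _ "- G k (u - h / 2)"]) simp
  qed (use k in \<open>intro continuous_G, simp\<close>)
  moreover have "G (Suc k) t0 \<le> G (Suc k) \<bar>t\<bar>"
    using t0 h_pos by (intro decreasing_if_slope_nonneg[OF k nn]) auto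
  moreover have "G (Suc k) \<bar>t\<bar> = G (Suc k) t" using even[of "Suc k" t] by (simp add: abs_if)
  ultimately show ?thesis using zero_half[of "Suc k"] by simp
qed

lemma hump: "k \<ge> 1 \<Longrightarrow> (\<forall>t. \<bar>t\<bar> \<le> h / 2 \<longrightarrow> G k t \<ge> 0) \<and> (\<forall>t. \<bar>t\<bar> < w \<longrightarrow> G k t > 0)"
proof (induction k rule: dec_induct)
  case base
  show ?case using G1_nonneg G1_pos by simp
next
  case (step k)
  have pos: "G (Suc k) t > 0" if "\<bar>t\<bar> < h / 2" for t
    using step that by (intro pos_inside_if_slope_nonneg) auto
  have "G (Suc k) t \<ge> 0" if "\<bar>t\<bar> \<le> h / 2" for t
  proof (cases "\<bar>t\<bar> = h / 2")
    case True
    then have "t = h / 2 \<or> t = - (h / 2)" by (auto simp: abs_if split: if_splits)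
    then show ?thesis using zero_half[of "Suc k"] even[of "Suc k" "h / 2"] by auto
  next
    case False
    then show ?thesis using pos[of t] that by simp
  qed
  then show ?case using pos w by auto
qed

lemma nonneg: "k \<ge> 1 \<Longrightarrow> \<bar>t\<bar> \<le> h / 2 \<Longrightarrow> G k t \<ge> 0"
  using hump by blast

lemma antimono: "k \<ge> 1 \<Longrightarrow> 0 \<le> s \<Longrightarrow> s \<le> t \<Longrightarrow> t \<le> h \<Longrightarrow> G (Suc k) t \<le> G (Suc k) s"
  by (intro decreasing_if_slope_nonneg nonneg)

lemma pos: "k \<ge> 1 \<Longrightarrow> \<bar>t\<bar> < h / 2 \<Longrightarrow> G (Suc k) t > 0"
  using hump[of k] by (intro pos_inside_if_slope_nonneg) auto

lemma strict_antimono: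
  assumes k: "k \<ge> 1" and st: "0 \<le> s" "s < t" "t \<le> h"
  shows "G (Suc (Suc k)) t < G (Suc (Suc k)) s"
proof (rule DERIV_neg_imp_decreasing_open[OF st(2)])
  fix u assume "s < u" "u < t"
  then have "G (Suc k) (u - h / 2) > 0" using st by (intro pos[OF k]) linarith
  then show "\<exists>y. (G (Suc (Suc k)) has_real_derivative y) (at u) \<and> y < 0"
    using deriv'[of "Suc k" u] by (intro exI[of _ "- G (Suc k) (u - h / 2)"]) simp
qed (intro continuous_G, simp)

lemma slope_neg:
  assumes k: "k \<ge> 1" and t: "flat (Suc k) < t" "t \<le> h / 2"
  shows "G k (t + h / 2) < 0"
proof -
  have "G k (t - h / 2) > 0"
  proof (cases "k = 1")
    case True
    have "G 1 (t - h / 2) > 0"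
    proof (rule G1_pos)
      have "h / 2 - w < t" using t True by (simp add: flat_def)
      then show "\<bar>t - h / 2\<bar> < w" using t w by linarith
    qed
    then show ?thesis using True by simp
  next
    case False
    then have "G (Suc (k - 1)) (t - h / 2) > 0"
      using t k h_pos by (intro pos) (auto simp: flat_def abs_less_iff)
    then show ?thesis using k by simp
  qed
  then show ?thesis using shift_half[OF k, of t] by simp
qed

lemma flat_value:
  assumes k: "k \<ge> 1" shows "G (Suc k) (flat (Suc k)) = G (Suc k) 0"
proof (cases "k = 1")
  case False
  then show ?thesis by (simp add: flat_def)
next
  case True
  show ?thesis
  proof (cases "h / 2 = w")
    case wne: False
    have "G 2 (h / 2 - w) = G 2 0"
    proof (rule DERIV_isconst_end[of 0 "h / 2 - w" "G 2"])
      show "0 < h / 2 - w" using wne w by simp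
      fix x assume x: "0 < x" "x < h / 2 - w"
      have "G 1 (x - h / 2) = 0" using x w by (intro G1_zero) auto
      then show "(G 2 has_real_derivative 0) (at x)"
        using deriv'[of 1 x] by (simp add: numeral_2_eq_2)
    qed (auto intro: continuous_G)
    then show ?thesis using True by (simp add: flat_def numeral_2_eq_2)
  next
    case weq: True
    have "flat (Suc k) = 0" unfolding flat_def weq by simp
    then show ?thesis by simp
  qed
qed

lemma shift_int:
  assumes k: "k \<ge> 1" shows "G k (t + of_int n * h) = (if even n then 1 else -1) * G k t"
proof (induction n rule: int_induct[where k = 0])
  case (step1 i)
  have "G k (t + of_int (i + 1) * h) = - G k (t + of_int i * h)"
    using anti[OF k, of "t + of_int i * h"] by (simp add: algebra_simps)
  then show ?case using step1 by auto
next
  case (step2 i)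
  have "G k (t + of_int i * h) = - G k (t + of_int (i - 1) * h)"
    using anti[OF k, of "t + of_int (i - 1) * h"] by (simp add: algebra_simps)
  then show ?case using step2 by auto
qed simp

lemma reduce_to_hump:
  obtains n :: int and s where "t = s + of_int n * h" "\<bar>s\<bar> \<le> h / 2"
proof -
  define n where "n = round (t / h)"
  have "\<bar>of_int n - t / h\<bar> \<le> 1 / 2" unfolding n_def by (rule of_int_round_abs_le)
  then have "\<bar>of_int n - t / h\<bar> * h \<le> 1 / 2 * h" using h_pos by (intro mult_right_mono) auto
  also have "\<bar>of_int n - t / h\<bar> * h = \<bar>(of_int n - t / h) * h\<bar>" using h_pos by (simp add: abs_mult)
  also have "(of_int n - t / h) * h = of_int n * h - t" using h_pos by (simp add: field_simps)
  finally have "\<bar>t - of_int n * h\<bar> \<le> h / 2" by (simp add: abs_minus_commute)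
  then show thesis using that[of "t - of_int n * h" n] by simp
qed

lemma peak: "k \<ge> 1 \<Longrightarrow> \<bar>G (Suc k) t\<bar> \<le> G (Suc k) 0"
proof -
  assume k: "k \<ge> 1"
  obtain n :: int and s where s: "t = s + of_int n * h" "\<bar>s\<bar> \<le> h / 2" by (rule reduce_to_hump)
  have "\<bar>G (Suc k) t\<bar> = \<bar>G (Suc k) s\<bar>" unfolding s(1) using shift_int[of "Suc k" s n] by simp
  also have "\<dots> = G (Suc k) s" using nonneg[of "Suc k" s] s by simp
  also have "\<dots> = G (Suc k) \<bar>s\<bar>" using even[of "Suc k" s] by (simp add: abs_if)
  also have "\<dots> \<le> G (Suc k) 0" using s h_pos by (intro antimono[OF k]) auto
  finally show ?thesis .
qed

text \<open>Both sides are even and \<open>h\<close>-periodic, so the identity extends from the quarter period on which it is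
assumed.\<close>

lemma energy: "(G 1 (t + h / 2))\<^sup>2 = 2 * K * (G 2 0 - \<bar>G 2 t\<bar>)"
proof -
  obtain n :: int and s where s: "t = s + of_int n * h" "\<bar>s\<bar> \<le> h / 2" by (rule reduce_to_hump)
  have *: "t + h / 2 = (s + h / 2) + of_int n * h" using s(1) by simp
  have "\<bar>G 1 (t + h / 2)\<bar> = \<bar>G 1 (s + h / 2)\<bar>" unfolding * using shift_int[of 1 "s + h / 2" n] by simp
  also have "\<dots> = \<bar>G 1 (\<bar>s\<bar> + h / 2)\<bar>"
    using shift_half[of 1 "- s"] even[of 1 "s + h / 2"] by (simp add: abs_if)
  finally have "(G 1 (t + h / 2))\<^sup>2 = (G 1 (\<bar>s\<bar> + h / 2))\<^sup>2" using power2_eq_iff by (metis power2_abs)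
  also have "\<dots> = 2 * K * (G 2 0 - G 2 \<bar>s\<bar>)" using s by (intro G2_energy) auto
  also have "G 2 \<bar>s\<bar> = G 2 s" using even[of 2 s] by (simp add: abs_if)
  also have "G 2 s = \<bar>G 2 t\<bar>" using shift_int[of 2 s n] nonneg[of 2 s] s by auto
  finally show ?thesis .
qed

text \<open>The graph of \<open>F\<close>, translated horizontally so as to meet that of \<open>G (Suc k)\<close>, is never steeper there;
\<open>D\<close> stands for the derivative of \<open>F\<close>.\<close>

definition slope_dominated :: "nat \<Rightarrow> (real \<Rightarrow> real) \<Rightarrow> (real \<Rightarrow> real) \<Rightarrow> bool" where
  "slope_dominated k F D \<longleftrightarrow> (\<forall>t u. F t = G (Suc k) u \<longrightarrow> \<bar>D t\<bar> \<le> \<bar>G k (u + h / 2)\<bar>)"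

lemma slope_dominated_base:
  assumes f: "\<And>t. (f has_real_derivative D t) (at t)"
    and D: "\<And>s t. \<bar>D t - D s\<bar> \<le> K * \<bar>t - s\<bar>" and M: "\<And>t. \<bar>f t\<bar> \<le> G 2 0"
  shows "slope_dominated 1 f D"
  unfolding slope_dominated_def
proof (intro allI impI)
  fix t u assume eq: "f t = G (Suc 1) u"
  have "(D t)\<^sup>2 \<le> 2 * K * (G 2 0 - \<bar>f t\<bar>)" by (rule landau_pointwise[OF f D K M])
  also have "\<dots> = (G 1 (u + h / 2))\<^sup>2" using energy[of u] eq by (simp add: numeral_2_eq_2)
  finally show "\<bar>D t\<bar> \<le> \<bar>G 1 (u + h / 2)\<bar>" by (simp add: abs_le_square_iff)
qed

lemma slope_dominated_uminus:
  "slope_dominated k F D \<Longrightarrow> k \<ge> 1 \<Longrightarrow> slope_dominated k (\<lambda>t. - F t) (\<lambda>t. - D t)"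
  unfolding slope_dominated_def
proof (intro allI impI)
  fix t u assume dom: "\<forall>t u. F t = G (Suc k) u \<longrightarrow> \<bar>D t\<bar> \<le> \<bar>G k (u + h / 2)\<bar>" and k: "k \<ge> 1"
    and "- F t = G (Suc k) u"
  then have "F t = G (Suc k) (u + h)" using anti[of "Suc k" u] by simp
  then have "\<bar>D t\<bar> \<le> \<bar>G k (u + h + h / 2)\<bar>" using dom by blast
  also have "u + h + h / 2 = (u + h / 2) + h" by simp
  also have "\<bar>G k ((u + h / 2) + h)\<bar> = \<bar>G k (u + h / 2)\<bar>" by (subst anti[OF k]) simp
  finally show "\<bar>- D t\<bar> \<le> \<bar>G k (u + h / 2)\<bar>" by simp
qed

lemma slope_dominated_reflect:
  "slope_dominated k F D \<Longrightarrow> slope_dominated k (\<lambda>t. F (- t)) (\<lambda>t. - D (- t))"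
  unfolding slope_dominated_def by simp

text \<open>Where the translated graphs meet, \<open>F\<close> falls at most as fast as \<open>G (Suc k)\<close>. Such a weak inequality
between slopes does not exclude a crossing, so \<open>F\<close> is compared with copies of \<open>G (Suc k)\<close> that start
slightly lower and run through their values faster, by the factor \<open>1 + e\<close>. For these the inequality is strict, and \<open>e\<close> is sent to
zero afterwards.\<close>

lemma slow_decay:
  assumes k: "k \<ge> 1" and F: "\<And>t. (F has_real_derivative D t) (at t)"
    and dom: "slope_dominated k F D"
    and u0: "flat (Suc k) \<le> u0" and start: "F \<tau> \<ge> G (Suc k) u0"
    and s: "0 \<le> s" "u0 + s < h / 2"
  shows "F (\<tau> + s) \<ge> G (Suc k) (u0 + s)"
proof -
  let ?G = "G (Suc k)"
  have u0': "0 \<le> u0" using u0 flat_bounds(1)[of "Suc k"] by simp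
  have perturbed: "F (\<tau> + s) > ?G (u0 + e + (1 + e) * s)" if e: "e > 0" "u0 + e + (1 + e) * s \<le> h / 2" for e
  proof (rule ccontr)
    assume neg: "\<not> F (\<tau> + s) > ?G (u0 + e + (1 + e) * s)"
    define H where "H t = F (\<tau> + t) - ?G (u0 + e + (1 + e) * t)" for t
    define H' where "H' t = D (\<tau> + t) - G k (u0 + e + (1 + e) * t + h / 2) * (1 + e)" for t
    have dH: "(H has_real_derivative H' t) (at t)" for t
      unfolding H_def[abs_def] H'_def
      by (rule derivative_eq_intros DERIV_chain2[OF F] DERIV_chain2[OF deriv[OF k]] refl | simp)+
    have contH: "continuous_on A H" for A
      using dH by (intro DERIV_continuous_on) (auto intro: has_field_derivative_at_within)
    have small: "u0 + e + (1 + e) * t \<le> h / 2" if "t \<le> s" for t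
    proof -
      have "(1 + e) * t \<le> (1 + e) * s" using that e by (intro mult_left_mono) auto
      then show ?thesis using e by linarith
    qed
    have H0: "H 0 > 0"
    proof -
      have "u0 + e \<le> h / 2" using small[of 0] s by simp
      have "?G (u0 + e) < ?G u0"
      proof (rule DERIV_neg_imp_decreasing_open[of u0 "u0 + e" ?G])
        show "u0 < u0 + e" using e by simp
        fix v assume "u0 < v" "v < u0 + e"
        then have "G k (v + h / 2) < 0"
          using u0 \<open>u0 + e \<le> h / 2\<close> by (intro slope_neg[OF k]) auto
        then show "\<exists>y. (?G has_real_derivative y) (at v) \<and> y < 0" using deriv[OF k] by blast
      qed (use k in \<open>intro continuous_G, simp\<close>)
      then show ?thesis using start by (simp add: H_def)
    qed
    (* At the first zero of H the derivative of H would have to be nonpositive. *)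
    define Z where "Z = {t \<in> {0..s}. H t \<le> 0}"
    have "closed Z"
      unfolding Z_def by (intro continuous_on_closed_Collect_le contH continuous_on_const closed_atLeastAtMost)
    then have "compact Z"
      by (auto simp: compact_eq_bounded_closed Z_def intro: bounded_subset[of "{0..s}"])
    moreover have "s \<in> Z" using neg s by (simp add: Z_def H_def)
    ultimately obtain s0 where s0: "s0 \<in> Z" "\<And>t. t \<in> Z \<Longrightarrow> s0 \<le> t"
      using compact_attains_inf[of Z] by blast
    have s0': "0 \<le> s0" "s0 \<le> s" "H s0 \<le> 0" using s0(1) by (auto simp: Z_def)
    obtain z where z: "0 \<le> z" "z \<le> s0" "H z = 0"
      using IVT2'[of H s0 0 0] s0' H0 contH by auto
    then have "z \<in> Z" using s0' by (simp add: Z_def)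
    then have Hs0: "H s0 = 0" using s0(2)[of z] z by simp
    then have "s0 > 0" using s0' H0 by (cases "s0 = 0") auto
    let ?c = "u0 + e + (1 + e) * s0"
    have neg_slope: "G k (?c + h / 2) < 0"
    proof (rule slope_neg[OF k])
      have "0 \<le> (1 + e) * s0" using e s0' by (intro mult_nonneg_nonneg) auto
      then show "flat (Suc k) < ?c" using u0 e by linarith
      show "?c \<le> h / 2" using small s0' by simp
    qed
    have "F (\<tau> + s0) = ?G ?c" using Hs0 by (simp add: H_def)
    then have "\<bar>D (\<tau> + s0)\<bar> \<le> \<bar>G k (?c + h / 2)\<bar>" using dom unfolding slope_dominated_def by blast
    then have "D (\<tau> + s0) \<ge> G k (?c + h / 2)" using neg_slope by simp
    moreover have "e * G k (?c + h / 2) < 0" using e neg_slope by (simp add: mult_pos_neg)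
    ultimately have "H' s0 > 0" by (simp add: H'_def algebra_simps)
    from DERIV_pos_inc_left[OF dH this] obtain d where
      d: "d > 0" "\<And>t. 0 < t \<Longrightarrow> t < d \<Longrightarrow> H (s0 - t) < H s0" by blast
    define t where "t = min d s0 / 2"
    have t: "0 < t" "t < d" "t < s0" using d \<open>s0 > 0\<close> by (auto simp: t_def)
    then have "s0 - t \<in> Z" using d(2)[of t] Hs0 s0' by (simp add: Z_def)
    then show False using s0(2)[of "s0 - t"] t by simp
  qed
  have lim: "((\<lambda>e. ?G (u0 + e + (1 + e) * s)) \<longlongrightarrow> ?G (u0 + s)) (at_right 0)"
  proof -
    have "continuous_on UNIV (\<lambda>e. ?G (u0 + e + (1 + e) * s))"
      by (intro continuous_on_compose2[OF continuous_G[of "Suc k" UNIV]] continuous_intros) (use k in auto)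
    then have "isCont (\<lambda>e. ?G (u0 + e + (1 + e) * s)) 0"
      by (simp add: continuous_on_eq_continuous_at)
    then show ?thesis by (auto simp: isCont_def intro: tendsto_mono[OF at_le])
  qed
  have "\<forall>\<^sub>F e in at_right 0. ?G (u0 + e + (1 + e) * s) \<le> F (\<tau> + s)"
  proof -
    define e0 where "e0 = (h / 2 - u0 - s) / (1 + s)"
    have "e0 > 0" using s by (simp add: e0_def)
    then have "\<forall>\<^sub>F e in at_right 0. e \<in> {0<..<e0}" by (rule eventually_at_right_real)
    then show ?thesis
    proof eventually_elim
      case (elim e)
      have "e * (1 + s) < e0 * (1 + s)" using elim s by (intro mult_strict_right_mono) auto
      also have "\<dots> = h / 2 - u0 - s" using s by (simp add: e0_def)
      finally show ?case using perturbed[of e] elim by (simp add: algebra_simps)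
    qed
  qed
  from tendsto_upperbound[OF lim this] show ?thesis by simp
qed

text \<open>The integral of \<open>slow_decay\<close> over the time that \<open>G (Suc k)\<close> needs from \<open>u0\<close> to its zero. The shifted
function \<open>G (Suc (Suc k)) (u - h / 2)\<close> is a primitive of \<open>G (Suc k)\<close>, and it attains its maximum at
\<open>u = h / 2\<close>.\<close>

lemma overshoot:
  assumes k: "k \<ge> 1" and f: "\<And>t. (f has_real_derivative F t) (at t)"
    and F: "\<And>t. (F has_real_derivative D t) (at t)" and dom: "slope_dominated k F D"
    and u0: "flat (Suc k) \<le> u0" "u0 \<le> h / 2" and start: "F \<tau> \<ge> G (Suc k) u0"
  shows "G (Suc (Suc k)) 0 - G (Suc (Suc k)) (u0 - h / 2) \<le> f (\<tau> + (h / 2 - u0)) - f \<tau>"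
proof (cases "u0 = h / 2")
  case False
  then have L: "0 < h / 2 - u0" using u0 by simp
  let ?S = "G (Suc (Suc k))"
  define H where "H s = f (\<tau> + s) - ?S (u0 + s - h / 2)" for s
  have dH: "(H has_real_derivative F (\<tau> + s) - G (Suc k) (u0 + s)) (at s)" for s
  proof -
    have "((\<lambda>s. ?S (u0 + s - h / 2)) has_real_derivative G (Suc k) (u0 + s - h / 2 + h / 2) * 1) (at s)"
      by (rule DERIV_chain2[OF deriv]) (auto intro!: derivative_eq_intros)
    moreover have "((\<lambda>s. f (\<tau> + s)) has_real_derivative F (\<tau> + s) * 1) (at s)"
      by (rule DERIV_chain2[OF f]) (auto intro!: derivative_eq_intros)
    ultimately show ?thesis unfolding H_def[abs_def] using DERIV_diff by fastforce
  qed
  have "H 0 \<le> H (h / 2 - u0)"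
  proof (rule DERIV_nonneg_imp_increasing_open[of 0 "h / 2 - u0" H])
    show "continuous_on {0..h / 2 - u0} H"
      using dH by (intro DERIV_continuous_on) (auto intro: has_field_derivative_at_within)
    fix s assume "0 < s" "s < h / 2 - u0"
    then have "F (\<tau> + s) - G (Suc k) (u0 + s) \<ge> 0"
      using slow_decay[OF k F dom u0(1) start, of s] by simp
    then show "\<exists>y. (H has_real_derivative y) (at s) \<and> 0 \<le> y" using dH by blast
  qed (use L in simp)
  then show ?thesis by (simp add: H_def)
next
  case True
  show ?thesis unfolding True by simp
qed

text \<open>If \<open>f\<close> were steeper at the crossing, then the slope of \<open>f\<close> would equal a value that \<open>G (Suc k)\<close> takes
earlier, at some \<open>u < v\<close>. From there on \<open>f\<close> would rise by more than what separates
it from the maximum of \<open>G (Suc (Suc k))\<close>.\<close>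

lemma no_steep_crossing:
  assumes k: "k \<ge> 1" and f: "\<And>t. (f has_real_derivative F t) (at t)"
    and F: "\<And>t. (F has_real_derivative D t) (at t)" and dom: "slope_dominated k F D"
    and boundF: "\<And>t. F t \<le> G (Suc k) 0" and boundf: "\<And>t. \<bar>f t\<bar> \<le> G (Suc (Suc k)) 0"
    and v: "0 \<le> v" "v \<le> h / 2" and start: "f \<tau> = G (Suc (Suc k)) (v - h / 2)"
  shows "F \<tau> \<le> G (Suc k) v"
proof (rule ccontr)
  assume "\<not> F \<tau> \<le> G (Suc k) v"
  then have steep: "F \<tau> > G (Suc k) v" by simp
  have "G (Suc k) v \<ge> 0" using v k by (intro nonneg) auto
  have "\<exists>u\<ge>flat (Suc k). u \<le> h / 2 \<and> G (Suc k) u = F \<tau>"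
    by (rule IVT2')
      (use steep \<open>G (Suc k) v \<ge> 0\<close> boundF[of \<tau>] zero_half[of "Suc k"] flat_bounds[of "Suc k"]
        flat_value[OF k] k in \<open>auto intro: continuous_G\<close>)
  then obtain u where u: "flat (Suc k) \<le> u" "u \<le> h / 2" "G (Suc k) u = F \<tau>" by blast
  have "0 \<le> u" using u(1) flat_bounds(1)[of "Suc k"] by simp
  have uv: "u < v"
  proof (rule ccontr)
    assume "\<not> u < v"
    then have "G (Suc k) u \<le> G (Suc k) v" using v u h_pos by (intro antimono[OF k]) auto
    then show False using steep u by simp
  qed
  let ?S = "G (Suc (Suc k))"
  have "?S (h / 2 - u) < ?S (h / 2 - v)"
    using uv u v h_pos \<open>0 \<le> u\<close> by (intro strict_antimono[OF k]) auto
  then have "?S (u - h / 2) < ?S (v - h / 2)"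
    using even[of "Suc (Suc k)" "h / 2 - u"] even[of "Suc (Suc k)" "h / 2 - v"] by simp
  moreover have "?S 0 - ?S (u - h / 2) \<le> f (\<tau> + (h / 2 - u)) - f \<tau>"
    by (rule overshoot[OF k f F dom u(1,2)]) (use u(3) in simp)
  ultimately have "?S 0 < f (\<tau> + (h / 2 - u))" using start by simp
  then show False using boundf[of "\<tau> + (h / 2 - u)"] by (simp add: abs_le_iff)
qed

text \<open>All positions of a crossing reduce to the one treated in \<open>no_steep_crossing\<close>: translations by \<open>h\<close>,
the reflection \<open>- f (- t)\<close> and the negation \<open>- f\<close> preserve the hypotheses.\<close>

lemma slope_dominated_step:
  assumes k: "k \<ge> 1" and f: "\<And>t. (f has_real_derivative F t) (at t)"
    and F: "\<And>t. (F has_real_derivative D t) (at t)" and dom: "slope_dominated k F D"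
    and boundF: "\<And>t. \<bar>F t\<bar> \<le> G (Suc k) 0" and boundf: "\<And>t. \<bar>f t\<bar> \<le> G (Suc (Suc k)) 0"
  shows "slope_dominated (Suc k) f F"
proof -
  have odd: "G (Suc (Suc k)) (- v - h / 2) = - G (Suc (Suc k)) (v - h / 2)" for v
    using shift_half[of "Suc (Suc k)" v] even[of "Suc (Suc k)" "v + h / 2"] by simp
  have one_sided: "F \<tau> \<le> G (Suc k) v"
    if f: "\<And>t. (f has_real_derivative F t) (at t)"
      and F: "\<And>t. (F has_real_derivative D t) (at t)" and dom: "slope_dominated k F D"
      and boundF: "\<And>t. \<bar>F t\<bar> \<le> G (Suc k) 0" and boundf: "\<And>t. \<bar>f t\<bar> \<le> G (Suc (Suc k)) 0"
      and v: "\<bar>v\<bar> \<le> h / 2" and eq: "f \<tau> = G (Suc (Suc k)) (v - h / 2)"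
    for f F D :: "real \<Rightarrow> real" and v \<tau>
  proof (cases "v \<ge> 0")
    case True
    show ?thesis
      by (rule no_steep_crossing[OF k f F dom _ boundf True _ eq]) (use boundF v in \<open>auto simp: abs_le_iff\<close>)
  next
    case False
    have "F (- (- \<tau>)) \<le> G (Suc k) (- v)"
    proof (rule no_steep_crossing[OF k, of "\<lambda>t. - f (- t)" "\<lambda>t. F (- t)" "\<lambda>t. - D (- t)" "- v" "- \<tau>"])
      show "((\<lambda>t. - f (- t)) has_real_derivative F (- t)) (at t)" for t
        by (rule derivative_eq_intros DERIV_chain2[OF f] refl | simp)+
      show "((\<lambda>t. F (- t)) has_real_derivative - D (- t)) (at t)" for t
        by (rule DERIV_mirror[THEN iffD1, OF F])
      show "slope_dominated k (\<lambda>t. F (- t)) (\<lambda>t. - D (- t))" by (rule slope_dominated_reflect[OF dom])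
      show "F (- t) \<le> G (Suc k) 0" for t using boundF[of "- t"] by (simp add: abs_le_iff)
      show "\<bar>- f (- t)\<bar> \<le> G (Suc (Suc k)) 0" for t using boundf[of "- t"] by simp
      show "0 \<le> - v" "- v \<le> h / 2" using False v by auto
      show "- f (- (- \<tau>)) = G (Suc (Suc k)) (- v - h / 2)" using eq odd[of v] by simp
    qed
    then show ?thesis using even[of "Suc k" v] by simp
  qed
  show ?thesis unfolding slope_dominated_def
  proof (intro allI impI)
    fix \<tau> \<xi> assume eq: "f \<tau> = G (Suc (Suc k)) \<xi>"
    obtain n :: int and v where v: "\<xi> + h / 2 = v + of_int n * h" "\<bar>v\<bar> \<le> h / 2" by (rule reduce_to_hump)
    define \<sigma> :: real where "\<sigma> = (if even n then 1 else -1)"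
    have "\<xi> = (v - h / 2) + of_int n * h" using v(1) by simp
    then have eq': "f \<tau> = \<sigma> * G (Suc (Suc k)) (v - h / 2)"
      unfolding eq \<sigma>_def using shift_int[of "Suc (Suc k)" "v - h / 2" n] by simp
    have "\<bar>G (Suc k) (\<xi> + h / 2)\<bar> = \<bar>G (Suc k) v\<bar>"
      unfolding v(1) using shift_int[of "Suc k" v n] by simp
    also have "\<dots> = G (Suc k) v" using nonneg[of "Suc k" v] v by simp
    finally have goal: "\<bar>G (Suc k) (\<xi> + h / 2)\<bar> = G (Suc k) v" .
    have odd': "\<sigma> * G (Suc (Suc k)) (v - h / 2) = G (Suc (Suc k)) (\<sigma> * v - h / 2)"
      "- (\<sigma> * G (Suc (Suc k)) (v - h / 2)) = G (Suc (Suc k)) (- \<sigma> * v - h / 2)"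
      "G (Suc k) (\<sigma> * v) = G (Suc k) v" "G (Suc k) (- \<sigma> * v) = G (Suc k) v"
      using odd[of v] even[of "Suc k" v] by (auto simp: \<sigma>_def)
    have v': "\<bar>\<sigma> * v\<bar> \<le> h / 2" "\<bar>- \<sigma> * v\<bar> \<le> h / 2" using v(2) by (auto simp: \<sigma>_def)
    have "F \<tau> \<le> G (Suc k) (\<sigma> * v)"
      by (rule one_sided[OF f F dom boundF boundf v'(1)]) (use eq' odd' in simp)
    moreover have "- F \<tau> \<le> G (Suc k) (- \<sigma> * v)"
    proof (rule one_sided[OF _ _ slope_dominated_uminus[OF dom k] _ _ v'(2)])
      show "((\<lambda>t. - f t) has_real_derivative - F t) (at t)" for t by (rule DERIV_minus[OF f])
      show "((\<lambda>t. - F t) has_real_derivative - D t) (at t)" for t by (rule DERIV_minus[OF F])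
      show "- f \<tau> = G (Suc (Suc k)) (- \<sigma> * v - h / 2)" using eq' odd'(2) by simp
    qed (use boundF boundf in simp_all)
    ultimately show "\<bar>F \<tau>\<bar> \<le> \<bar>G (Suc k) (\<xi> + h / 2)\<bar>" using goal odd' by simp
  qed
qed

text \<open>If \<open>f'\<close> came too close to the maximum of \<open>G (Suc k)\<close>, then \<open>f\<close> would rise, counting both sides of that
point, by almost twice the maximum of \<open>G (Suc (Suc k))\<close>, more than the \<open>2 m\<close> that its bound allows. For \<open>k = 1\<close>
this fails: the rise over the plateau of \<open>G 2\<close> would be lost.\<close>

lemma strict_bound_derivative:
  assumes k: "k \<ge> 2" and f: "\<And>t. (f has_real_derivative F t) (at t)"
    and F: "\<And>t. (F has_real_derivative D t) (at t)" and dom: "slope_dominated k F D"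
    and m: "m < G (Suc (Suc k)) 0" and bound: "\<And>t. \<bar>f t\<bar> \<le> m"
  obtains v where "v < G (Suc k) 0" "\<And>t. \<bar>F t\<bar> \<le> v"
proof -
  let ?S = "G (Suc (Suc k))"
  have k1: "k \<ge> 1" using k by simp
  have S0: "?S (- (h / 2)) = 0" using zero_half[of "Suc (Suc k)"] even[of "Suc (Suc k)" "h / 2"] by simp
  have "isCont (\<lambda>u. ?S (u - h / 2)) 0"
    using continuous_on_compose2[OF continuous_G[of "Suc (Suc k)" UNIV], of UNIV "\<lambda>u. u - h / 2"]
    by (simp add: continuous_on_eq_continuous_at continuous_on_diff)
  then have "(\<lambda>u. ?S (u - h / 2)) \<midarrow>0\<rightarrow> 0" using S0 by (simp add: isCont_def)
  then have "\<forall>\<^sub>F u in at_right 0. ?S (u - h / 2) < ?S 0 - m"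
    using m by (intro order_tendstoD(2)[of _ 0]) (auto intro: tendsto_mono[OF at_le])
  moreover have "\<forall>\<^sub>F u in at_right 0. u \<in> {0<..<h / 2}"
    using h_pos by (intro eventually_at_right_real) simp
  ultimately have "\<forall>\<^sub>F u in at_right 0. ?S (u - h / 2) < ?S 0 - m \<and> u \<in> {0<..<h / 2}"
    by (rule eventually_conj)
  then obtain u where u: "?S (u - h / 2) < ?S 0 - m" "0 < u" "u < h / 2"
    using eventually_happens'[OF trivial_limit_at_right_real] by auto
  have flat: "flat (Suc k) \<le> u" using k u by (simp add: flat_def)
  have one_sided: "F \<tau> \<le> G (Suc k) u"
    if f: "\<And>t. (f has_real_derivative F t) (at t)"
      and F: "\<And>t. (F has_real_derivative D t) (at t)" and dom: "slope_dominated k F D"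
      and bound: "\<And>t. \<bar>f t\<bar> \<le> m" for f F D :: "real \<Rightarrow> real" and \<tau>
  proof (rule ccontr)
    assume "\<not> F \<tau> \<le> G (Suc k) u"
    then have start: "F \<tau> \<ge> G (Suc k) u" by simp
    have "?S 0 - ?S (u - h / 2) \<le> f (\<tau> + (h / 2 - u)) - f \<tau>"
      by (rule overshoot[OF k1 f F dom flat _ start]) (use u in simp)
    moreover have "?S 0 - ?S (u - h / 2) \<le> - f (- (- \<tau> + (h / 2 - u))) - - f (- (- \<tau>))"
    proof (rule overshoot[OF k1 _ _ slope_dominated_reflect[OF dom] flat])
      show "((\<lambda>t. - f (- t)) has_real_derivative F (- t)) (at t)" for t
        by (rule derivative_eq_intros DERIV_chain2[OF f] refl | simp)+
      show "((\<lambda>t. F (- t)) has_real_derivative - D (- t)) (at t)" for t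
        by (rule DERIV_mirror[THEN iffD1, OF F])
    qed (use u start in simp_all)
    ultimately show False
      using u bound[of "\<tau> + (h / 2 - u)"] bound[of "- (- \<tau> + (h / 2 - u))"] by (simp add: abs_le_iff)
  qed
  have "G (Suc (Suc (k - 1))) u < G (Suc (Suc (k - 1))) 0"
    by (rule strict_antimono) (use k u h_pos in auto)
  then have "G (Suc k) u < G (Suc k) 0" using k1 by simp
  moreover have "\<bar>F \<tau>\<bar> \<le> G (Suc k) u" for \<tau>
  proof -
    have "F \<tau> \<le> G (Suc k) u" by (rule one_sided[OF f F dom bound])
    moreover have "- F \<tau> \<le> G (Suc k) u"
      by (rule one_sided[OF DERIV_minus[OF f] DERIV_minus[OF F] slope_dominated_uminus[OF dom k1]])
        (use bound in simp)
    ultimately show ?thesis by simp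
  qed
  ultimately show thesis using that by blast
qed

lemma slope_dominated_chain:
  assumes X: "\<And>i t. i \<le> n \<Longrightarrow> (X i has_real_derivative X (Suc i) t) (at t)"
    and lip: "\<And>s t. \<bar>X (Suc n) t - X (Suc n) s\<bar> \<le> K * \<bar>t - s\<bar>"
    and bound: "\<And>i t. i \<le> n \<Longrightarrow> \<bar>X i t\<bar> \<le> G (n + 2 - i) 0"
    and i: "i \<le> n"
  shows "slope_dominated (n + 1 - i) (X i) (X (Suc i))"
  using i
proof (induction rule: inc_induct)
  case base
  show ?case using slope_dominated_base[OF X lip] bound[of n] by simp
next
  case (step i)
  then have e: "n + 1 - i = Suc (n + 1 - Suc i)" "n + 2 - Suc i = Suc (n + 1 - Suc i)"
    "n + 2 - i = Suc (Suc (n + 1 - Suc i))" by auto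
  show ?case unfolding e(1)
  proof (rule slope_dominated_step[OF _ X X step.IH])
    show "\<bar>X (Suc i) t\<bar> \<le> G (Suc (n + 1 - Suc i)) 0" for t
      using bound[of "Suc i" t] step unfolding e by simp
    show "\<bar>X i t\<bar> \<le> G (Suc (Suc (n + 1 - Suc i))) 0" for t
      using bound[of i t] step unfolding e by simp
  qed (use step in auto)
qed

lemma strict_bound_chain:
  assumes X: "\<And>i t. i \<le> n \<Longrightarrow> (X i has_real_derivative X (Suc i) t) (at t)"
    and lip: "\<And>s t. \<bar>X (Suc n) t - X (Suc n) s\<bar> \<le> K * \<bar>t - s\<bar>"
    and bound: "\<And>i t. i \<le> n \<Longrightarrow> \<bar>X i t\<bar> \<le> G (n + 2 - i) 0"
    and m: "m < G (n + 2) 0" "\<And>t. \<bar>X 0 t\<bar> \<le> m"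
    and i: "i < n"
  shows "\<exists>v<G (n + 2 - i) 0. \<forall>t. \<bar>X i t\<bar> \<le> v"
  using i
proof (induction i)
  case 0
  show ?case using m by auto
next
  case (Suc i)
  then obtain m where m: "m < G (n + 2 - i) 0" "\<And>t. \<bar>X i t\<bar> \<le> m" by auto
  have e: "n + 2 - i = Suc (Suc (n + 1 - Suc i))" "n + 2 - Suc i = Suc (n + 1 - Suc i)"
    using Suc.prems by auto
  have dom: "slope_dominated (n + 1 - Suc i) (X (Suc i)) (X (Suc (Suc i)))"
    using Suc.prems by (intro slope_dominated_chain[OF X lip bound]) auto
  obtain v where "v < G (Suc (n + 1 - Suc i)) 0" "\<And>t. \<bar>X (Suc i) t\<bar> \<le> v"
    by (rule strict_bound_derivative[OF _ X X dom, of m])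
      (use Suc.prems m[unfolded e] in auto)
  then show ?case unfolding e by blast
qed

end

section \<open>Bounds on derivatives and essential suprema\<close>

text \<open>The induction replaces \<open>X\<close> by its first difference, which costs a factor \<open>2\<close> in the bound and, by
the mean value theorem, a unit of length in the location of the point.\<close>

lemma exists_small_derivative:
  assumes "\<And>i t. i < n \<Longrightarrow> (X i has_real_derivative X (Suc i) t) (at t)" "\<And>t. \<bar>X 0 t\<bar> \<le> M"
  shows "\<exists>s\<in>{t..t + real n}. \<bar>X n s\<bar> \<le> 2 ^ n * M"
  using assms
proof (induction n arbitrary: X M t)
  case 0
  then show ?case by simp
next
  case (Suc n)
  define Y where "Y i t = X i (t + 1) - X i t" for i t
  have "(Y i has_real_derivative Y (Suc i) t) (at t)" if "i < n" for i t
    unfolding Y_def[abs_def] using Suc.prems(1)[of i] that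
    by (intro DERIV_diff DERIV_shift[THEN iffD1]) auto
  moreover have "\<bar>Y 0 t\<bar> \<le> 2 * M" for t
    using Suc.prems(2)[of t] Suc.prems(2)[of "t + 1"] by (simp add: Y_def)
  ultimately obtain s where s: "s \<in> {t..t + real n}" "\<bar>Y n s\<bar> \<le> 2 ^ n * (2 * M)"
    using Suc.IH[of Y "2 * M" t] by blast
  obtain z where z: "s < z" "z < s + 1" "X n (s + 1) - X n s = (s + 1 - s) * X (Suc n) z"
    using MVT2[of s "s + 1" "X n" "X (Suc n)"] Suc.prems(1)[of n] by auto
  then show ?case using s by (intro bexI[of _ z]) (auto simp: Y_def mult.assoc)
qed

lemma bounded_intermediate_derivatives:
  assumes X: "\<And>i t. i < n \<Longrightarrow> (X i has_real_derivative X (Suc i) t) (at t)"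
    and X0: "\<And>t. \<bar>X 0 t\<bar> \<le> M" and Xn: "\<And>t. \<bar>X n t\<bar> \<le> B" and i: "i \<le> n"
  shows "\<exists>C. \<forall>t. \<bar>X i t\<bar> \<le> C"
  using i
proof (induction rule: inc_induct)
  case base
  show ?case using Xn by blast
next
  case (step i)
  then obtain C where C: "\<And>t. \<bar>X (Suc i) t\<bar> \<le> C" by blast
  have "\<bar>X i t\<bar> \<le> 2 ^ i * M + C * real i" for t
  proof -
    obtain s where s: "s \<in> {t..t + real i}" "\<bar>X i s\<bar> \<le> 2 ^ i * M"
      using exists_small_derivative[of i X M t] X X0 step by auto
    have "\<bar>X i s - X i t\<bar> \<le> C * \<bar>s - t\<bar>"
      using field_differentiable_bound[of UNIV "X i" "X (Suc i)" C s t] X[of i] C step by simp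
    also have "\<dots> \<le> C * real i" using s C[of 0] by (intro mult_left_mono) auto
    finally show ?thesis using s by linarith
  qed
  then show ?case by blast
qed

lemma AE_bound_continuous:
  assumes f: "continuous_on UNIV f" and ae: "AE t in lebesgue. \<bar>f t :: real\<bar> \<le> c"
  shows "\<bar>f (t::real)\<bar> \<le> c"
proof (rule ccontr)
  assume "\<not> \<bar>f t\<bar> \<le> c"
  let ?U = "{t. c < \<bar>f t\<bar>}"
  have "open ?U" by (intro open_Collect_less continuous_intros f)
  moreover have "negligible ?U"
  proof -
    have "?U \<in> sets lebesgue" using \<open>open ?U\<close> by (simp add: borel_open)
    moreover have "AE t in lebesgue. t \<notin> ?U" using ae by eventually_elim simp
    ultimately show ?thesis unfolding negligible_iff_null_sets using AE_iff_null_sets by blast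
  qed
  moreover have "t \<in> ?U" using \<open>\<not> \<bar>f t\<bar> \<le> c\<close> by simp
  ultimately show False using open_not_negligible[of ?U] by blast
qed

lemma AE_bound_if_Linf_norm_le:
  assumes "Linf_norm f \<le> ereal c" shows "AE t in lebesgue. \<bar>f t\<bar> \<le> c"
  using esssup_AE[of "\<lambda>t. ereal \<bar>f t\<bar>" lebesgue]
proof eventually_elim
  case (elim t)
  then have "ereal \<bar>f t\<bar> \<le> ereal c" using assms unfolding Linf_norm_def by (rule order_trans)
  then show ?case by simp
qed

lemma Linf_norm_le:
  assumes "f \<in> borel_measurable lebesgue" "AE t in lebesgue. \<bar>f t\<bar> \<le> c"
  shows "Linf_norm f \<le> ereal c"
  unfolding Linf_norm_def using assms by (intro esssup_I) auto

text \<open>Off \<open>C\<close> the derivative is a limit of continuous difference quotients, and a countable set does not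
affect measurability.\<close>

lemma borel_measurable_deriv:
  fixes f :: "real \<Rightarrow> real"
  assumes f: "continuous_on UNIV f" and C: "countable C"
    and diff: "\<And>t. t \<notin> C \<Longrightarrow> f field_differentiable (at t)"
  shows "deriv f \<in> borel_measurable borel"
proof -
  define q where "q n t = (f (t + 1 / real (Suc n)) - f t) / (1 / real (Suc n))" for n t
  have q: "q n \<in> borel_measurable borel" for n
    unfolding q_def[abs_def]
    by (intro borel_measurable_continuous_onI continuous_intros continuous_on_compose2[OF f]) auto
  have "(\<lambda>t. lim (\<lambda>n. q n t)) \<in> borel_measurable borel"
    by (rule borel_measurable_lim_metric[OF q])
  then show ?thesis
  proof (rule measurable_discrete_difference[OF _ C])
    fix t assume "t \<notin> C"
    then have "(f has_real_derivative deriv f t) (at t)"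
      using diff DERIV_deriv_iff_field_differentiable by blast
    then have "((\<lambda>h. (f (t + h) - f t) / h) \<longlongrightarrow> deriv f t) (at 0)" by (simp add: DERIV_def)
    moreover have "filterlim (\<lambda>n. 1 / real (Suc n)) (at 0) sequentially"
      unfolding filterlim_at using LIMSEQ_inverse_real_of_nat by (simp add: inverse_eq_divide)
    ultimately have "(\<lambda>n. q n t) \<longlonglongrightarrow> deriv f t"
      unfolding q_def by (rule filterlim_compose)
    then show "lim (\<lambda>n. q n t) = deriv f t" by (rule limI)
  qed auto
qed

section \<open>The comparison splines form such a chain\<close>

lemma psi1_half_shift:
  assumes a: "a \<ge> 0" shows "psi1 a (t + (a + 2)) = - psi1 a t"
proof -
  obtain m where m: "\<bar>t - (4 + 2*a) * of_int m\<bar> \<le> a + 2"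
    "psi1 a t = psi1_base a \<bar>t - (4 + 2*a) * of_int m\<bar>" by (rule psi1_eq_near[OF a])
  define m' where "m' = (if t - (4 + 2*a) * of_int m \<le> 0 then m else m + 1)"
  have m': "\<bar>t + (a + 2) - (4 + 2*a) * of_int m'\<bar> = a + 2 - \<bar>t - (4 + 2*a) * of_int m\<bar>"
    using m(1) unfolding m'_def by (auto simp: algebra_simps abs_if)
  then have "psi1 a (t + (a + 2)) = psi1_base a (a + 2 - \<bar>t - (4 + 2*a) * of_int m\<bar>)"
    using psi1_eq_base[OF a, of "t + (a + 2)" m'] by simp
  then show ?thesis using m a by (auto simp: psi1_base_def)
qed

text \<open>The sum of \<open>psi (Suc k) a\<close> and its translate has derivative zero by induction, and the constant is
zero because the mean value is.\<close>

lemma psi_half_shift: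
  assumes a: "a \<ge> 0" and k: "k \<ge> 1" shows "psi k a (t + (a + 2)) = - psi k a t"
  using k
proof (induction k arbitrary: t rule: dec_induct)
  case base
  show ?case using psi1_half_shift[OF a] psi_1 by simp
next
  case (step k)
  define F where "F = psi (Suc k) a"
  define T where "T = a + 2"
  have T: "T > 0" using a by (simp add: T_def)
  have dF: "(F has_real_derivative psi k a t) (at t)" for t
    unfolding F_def by (rule psi_derivative[OF a step(1)])
  have cF: "continuous_on UNIV F"
    using dF by (intro DERIV_continuous_on) (auto intro: has_field_derivative_at_within)
  have "\<forall>t. ((\<lambda>t. F (t + T) + F t) has_real_derivative 0) (at t)"
  proof
    fix t
    have "((\<lambda>t. F (t + T) + F t) has_real_derivative psi k a (t + T) + psi k a t) (at t)"
      by (intro DERIV_add dF DERIV_shift[THEN iffD1])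
    then show "((\<lambda>t. F (t + T) + F t) has_real_derivative 0) (at t)"
      using step.IH by (simp add: T_def)
  qed
  from DERIV_isconst_all[OF this] have const: "F (t + T) + F t = F T + F 0" for t
    by (metis add.left_neutral)
  have cFT: "continuous_on UNIV (\<lambda>u. F (u + T))"
    by (intro continuous_on_compose2[OF cF] continuous_intros) auto
  have "0 = (LBINT u=ereal 0..ereal (T + T). F u)"
    using psi_mean[OF a, of "Suc k"] by (simp add: F_def T_def zero_ereal_def algebra_simps)
  also have "\<dots> = (LBINT u=ereal 0..ereal T. F u) + (LBINT u=ereal (0 + T)..ereal (T + T). F u)"
    using LBINT_split[OF cF, of 0 "T + T" T] by simp
  also have "(LBINT u=ereal (0 + T)..ereal (T + T). F u) = (LBINT u=ereal 0..ereal T. F (u + T))"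
    by (rule LBINT_shift[OF cF, symmetric])
  also have "(LBINT u=ereal 0..ereal T. F u) + (LBINT u=ereal 0..ereal T. F (u + T)) =
      (LBINT u=ereal 0..ereal T. F u + F (u + T))"
    by (intro interval_lebesgue_integral_add(2)[symmetric] interval_integrable_continuous cF cFT)
  also have "\<dots> = (LBINT u=ereal 0..ereal T. F T + F 0)"
    using const by (simp add: add.commute)
  also have "\<dots> = (F T + F 0) * T" using T interval_integral_const(2)[of 0 T "F T + F 0"] by simp
  finally have "F T + F 0 = 0" using T by simp
  then show ?case using const[of t] by (simp add: F_def T_def)
qed

text \<open>Each integration moves the maxima of the spline to the right by a quarter period, \<open>(a + 2) / 2\<close>;
the translation compensates for this. For \<open>k = 1\<close> the maximum is at \<open>a + 2\<close>.\<close>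

definition centred_psi :: "nat \<Rightarrow> real \<Rightarrow> real \<Rightarrow> real" where
  "centred_psi k a t = psi k a (t + real (Suc k) * ((a + 2) / 2))"

lemma centred_psi_1: "a \<ge> 0 \<Longrightarrow> centred_psi 1 a t = - psi1 a t"
proof -
  assume a: "a \<ge> 0"
  have "t + real (Suc 1) * ((a + 2) / 2) = t + (a + 2)" by simp
  then show ?thesis using psi1_half_shift[OF a, of t] psi_1 by (simp only: centred_psi_def)
qed

lemma centred_psi_shift:
  "a \<ge> 0 \<Longrightarrow> k \<ge> 1 \<Longrightarrow> centred_psi k a (t + (a + 2)) = - centred_psi k a t"
  using psi_half_shift[of a k "t + real (Suc k) * ((a + 2) / 2)"]
  by (simp add: centred_psi_def algebra_simps)

lemma centred_psi_half_shift:
  assumes "a \<ge> 0" "k \<ge> 1"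
  shows "centred_psi k a (t + (a + 2) / 2) = - centred_psi k a (t - (a + 2) / 2)"
proof -
  have eq: "t + (a + 2) / 2 = (t - (a + 2) / 2) + (a + 2)" by (simp add: field_simps)
  show ?thesis by (subst eq) (rule centred_psi_shift[OF assms])
qed

lemma centred_psi_derivative:
  assumes "a \<ge> 0" "k \<ge> 1"
  shows "(centred_psi (Suc k) a has_real_derivative centred_psi k a (t + (a + 2) / 2)) (at t)"
proof -
  have "(centred_psi (Suc k) a has_real_derivative psi k a (t + real (Suc (Suc k)) * ((a + 2) / 2))) (at t)"
    unfolding centred_psi_def[abs_def] by (intro DERIV_shift[THEN iffD1] psi_derivative assms)
  moreover have "t + real (Suc (Suc k)) * ((a + 2) / 2) = t + (a + 2) / 2 + real (Suc k) * ((a + 2) / 2)"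
    by (simp add: field_simps)
  ultimately show ?thesis by (simp only: centred_psi_def)
qed

lemma centred_psi_even:
  assumes a: "a \<ge> 0" and k: "k \<ge> 1" shows "centred_psi k a (- t) = centred_psi k a t"
  using k
proof (induction k arbitrary: t rule: dec_induct)
  case base
  show ?case using centred_psi_1[OF a] psi1_even[OF a] by simp
next
  case (step k)
  let ?F = "centred_psi (Suc k) a"
  have "\<forall>t. ((\<lambda>t. ?F (- t) - ?F t) has_real_derivative 0) (at t)"
  proof
    fix t
    have "((\<lambda>t. ?F (- t) - ?F t) has_real_derivative
        - centred_psi k a (- t + (a + 2) / 2) - centred_psi k a (t + (a + 2) / 2)) (at t)"
      by (intro DERIV_diff DERIV_mirror[THEN iffD1] centred_psi_derivative a step)
    moreover have "centred_psi k a (- t + (a + 2) / 2) = centred_psi k a (t - (a + 2) / 2)"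
      using step.IH[of "t - (a + 2) / 2"] by simp
    moreover have "centred_psi k a (t + (a + 2) / 2) = - centred_psi k a (t - (a + 2) / 2)"
      by (rule centred_psi_half_shift[OF a step(1)])
    ultimately show "((\<lambda>t. ?F (- t) - ?F t) has_real_derivative 0) (at t)" by simp
  qed
  from DERIV_isconst_all[OF this, of t 0] show ?case by simp
qed

lemma centred_psi_1_hump:
  assumes a: "a \<ge> 0" and t: "\<bar>t\<bar> \<le> (a + 2) / 2"
  shows "centred_psi 1 a t = max 0 (1 - \<bar>t\<bar>)"
proof -
  have "psi1 a t = psi1_base a \<bar>t\<bar>" using psi1_eq_base[OF a, of t 0] t a by simp
  then show ?thesis using centred_psi_1[OF a, of t] t a by (auto simp: psi1_base_def)
qed

text \<open>On the quarter period, \<open>psi 2\<close> is a plateau of height \<open>1 / 2\<close> followed by the parabola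
\<open>y - y\<^sup>2 / 2\<close>, where \<open>y\<close> is the distance to the zero at \<open>(a + 2) / 2\<close>, and \<open>(1 - y)\<^sup>2 = 1 - 2 (y - y\<^sup>2 / 2)\<close>.\<close>

lemma centred_psi_2_energy:
  assumes a: "a \<ge> 0" and t: "0 \<le> t" "t \<le> (a + 2) / 2"
  shows "(centred_psi 1 a (t + (a + 2) / 2))\<^sup>2 = 2 * (centred_psi 2 a 0 - centred_psi 2 a t)"
proof -
  define H where "H = (a + 2) / 2"
  have H: "H \<ge> 1" using a by (simp add: H_def)
  let ?F = "centred_psi 2 a"
  have slope: "(?F has_real_derivative - max 0 (1 - \<bar>u - H\<bar>)) (at u)" "centred_psi 1 a (u + H) = - max 0 (1 - \<bar>u - H\<bar>)"
    if u: "0 \<le> u" "u \<le> H" for u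
  proof -
    have "centred_psi 1 a (u + H) = - centred_psi 1 a (u - H)"
      unfolding H_def by (rule centred_psi_half_shift[OF a]) simp
    also have "centred_psi 1 a (u - H) = max 0 (1 - \<bar>u - H\<bar>)"
      by (rule centred_psi_1_hump[OF a]) (use u H in \<open>unfold H_def[symmetric], linarith\<close>)
    finally show eq: "centred_psi 1 a (u + H) = - max 0 (1 - \<bar>u - H\<bar>)" .
    show "(?F has_real_derivative - max 0 (1 - \<bar>u - H\<bar>)) (at u)"
      using centred_psi_derivative[OF a, of 1 u] eq by (simp add: H_def numeral_2_eq_2)
  qed
  have cont: "continuous_on S ?F" for S
    using centred_psi_derivative[OF a, of 1]
    by (intro DERIV_continuous_on) (auto simp: numeral_2_eq_2 intro: has_field_derivative_at_within)
  have F_H: "?F H = 0"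
    using centred_psi_half_shift[OF a, of 2 0] centred_psi_even[OF a, of 2 H] by (simp add: H_def)
  have ramp: "?F u = (H - u) - (H - u)\<^sup>2 / 2" if u: "H - 1 \<le> u" "u \<le> H" for u
  proof (cases "u = H")
    case False
    have "?F H - ((H - H) - (H - H)\<^sup>2 / 2) = ?F u - ((H - u) - (H - u)\<^sup>2 / 2)"
    proof (rule DERIV_isconst_end[of u H "\<lambda>u. ?F u - ((H - u) - (H - u)\<^sup>2 / 2)"])
      show "u < H" using False u by simp
      show "continuous_on {u..H} (\<lambda>u. ?F u - ((H - u) - (H - u)\<^sup>2 / 2))"
        by (intro continuous_intros cont) simp
      fix v assume v: "u < v" "v < H"
      have "((\<lambda>u. (H - u) - (H - u)\<^sup>2 / 2) has_real_derivative - 1 + (H - v)) (at v)"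
        by (auto intro!: derivative_eq_intros simp: field_simps)
      moreover have "(?F has_real_derivative - max 0 (1 - \<bar>v - H\<bar>)) (at v)"
        using u v H by (intro slope(1)) auto
      ultimately have "((\<lambda>u. ?F u - ((H - u) - (H - u)\<^sup>2 / 2)) has_real_derivative
         - max 0 (1 - \<bar>v - H\<bar>) - (- 1 + (H - v))) (at v)"
        by (intro DERIV_diff)
      then show "((\<lambda>u. ?F u - ((H - u) - (H - u)\<^sup>2 / 2)) has_real_derivative 0) (at v)"
        using u v by simp
    qed
    then show ?thesis using F_H by simp
  qed (use F_H in simp)
  have plateau: "?F u = 1 / 2" if u: "0 \<le> u" "u \<le> H - 1" for u
  proof (cases "u = H - 1")
    case False
    have "?F (H - 1) = ?F u"
    proof (rule DERIV_isconst_end[of u "H - 1" ?F])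
      show "u < H - 1" using False u by simp
      fix v assume v: "u < v" "v < H - 1"
      then show "(?F has_real_derivative 0) (at v)" using slope(1)[of v] u by simp
    qed (rule cont)
    then show ?thesis using ramp[of "H - 1"] by simp
  next
    case True
    then show ?thesis using ramp[of "H - 1"] by simp
  qed
  have "?F 0 = 1 / 2" using plateau[of 0] H by simp
  moreover have "(max 0 (1 - \<bar>t - H\<bar>))\<^sup>2 = 1 - 2 * ?F t"
  proof (cases "t \<le> H - 1")
    case True
    then show ?thesis using plateau[of t] t by simp
  next
    case False
    then have "\<bar>t - H\<bar> = H - t" "1 - (H - t) \<ge> 0" using t by (auto simp: H_def)
    then have "max 0 (1 - \<bar>t - H\<bar>) = 1 - (H - t)" by simp
    moreover have "?F t = (H - t) - (H - t)\<^sup>2 / 2" using False t by (intro ramp) (auto simp: H_def)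
    moreover have "(1 - (H - t))\<^sup>2 = 1 - 2 * ((H - t) - (H - t)\<^sup>2 / 2)"
      by (simp add: power2_eq_square field_simps)
    ultimately show ?thesis by simp
  qed
  ultimately show ?thesis using slope(2)[of t] t by (simp add: H_def[symmetric])
qed

text \<open>The scale \<open>c\<close> is the parameter \<open>1 / \<lambda>\<close> of the splines, and \<open>K\<close> is the size of their top derivative. With \<open>K\<close> fixed,
varying \<open>c\<close> gives the family of dilations over which \<open>intermediate_norms_le\<close> optimises.\<close>

lemma comparison_chain_psi:
  assumes a: "a \<ge> 0" and c: "c > 0" and K: "K > 0"
  shows "comparison_chain (\<lambda>k t. K * c ^ k * centred_psi k a (t / c)) ((a + 2) * c) c K"
proof
  show "0 < c" "K > 0" by fact+
  have half: "(t + (a + 2) * c / 2) / c = t / c + (a + 2) / 2" for t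
    using c by (simp add: field_simps)
  show "c \<le> (a + 2) * c / 2" using a c by simp
  have hump: "centred_psi 1 a (t / c) = max 0 (1 - \<bar>t / c\<bar>)" if "\<bar>t\<bar> \<le> (a + 2) * c / 2" for t
  proof (rule centred_psi_1_hump[OF a])
    have "\<bar>t / c\<bar> = \<bar>t\<bar> / c" using c by simp
    also have "\<dots> \<le> (a + 2) / 2" using that c by (simp add: field_simps)
    finally show "\<bar>t / c\<bar> \<le> (a + 2) / 2" .
  qed
  show "0 \<le> K * c ^ 1 * centred_psi 1 a (t / c)" if "\<bar>t\<bar> \<le> (a + 2) * c / 2" for t
    using hump[OF that] K c by simp
  show "0 < K * c ^ 1 * centred_psi 1 a (t / c)" if t: "\<bar>t\<bar> < c" for t
  proof -
    have "\<bar>t\<bar> \<le> (a + 2) * c / 2" using t \<open>c \<le> (a + 2) * c / 2\<close> by simp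
    moreover have "\<bar>t / c\<bar> < 1" using t c by simp
    ultimately show ?thesis using hump[of t] K c by simp
  qed
  show "K * c ^ 1 * centred_psi 1 a (t / c) = 0" if "c \<le> \<bar>t\<bar>" "\<bar>t\<bar> \<le> (a + 2) * c / 2" for t
  proof -
    have "\<bar>t / c\<bar> \<ge> 1" using that c by simp
    then show ?thesis using hump[of t] that by simp
  qed
  show "(K * c ^ 1 * centred_psi 1 a ((t + (a + 2) * c / 2) / c))\<^sup>2 =
      2 * K * (K * c ^ 2 * centred_psi 2 a (0 / c) - K * c ^ 2 * centred_psi 2 a (t / c))"
    if "0 \<le> t" "t \<le> (a + 2) * c / 2" for t
  proof -
    have E: "(centred_psi 1 a (t / c + (a + 2) / 2))\<^sup>2 = 2 * (centred_psi 2 a 0 - centred_psi 2 a (t / c))"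
      by (rule centred_psi_2_energy[OF a]) (use that c in \<open>simp_all add: field_simps\<close>)
    have sq: "(K * c ^ 1 * z)\<^sup>2 = K\<^sup>2 * c\<^sup>2 * z\<^sup>2" for z by (simp add: power_mult_distrib)
    show ?thesis unfolding half sq E by (simp add: algebra_simps power2_eq_square)
  qed
  fix k :: nat assume k: "k \<ge> 1"
  show "K * c ^ k * centred_psi k a (- t / c) = K * c ^ k * centred_psi k a (t / c)" for t
    using centred_psi_even[OF a k, of "t / c"] by simp
  show "K * c ^ k * centred_psi k a ((t + (a + 2) * c) / c) = - (K * c ^ k * centred_psi k a (t / c))" for t
    using centred_psi_shift[OF a k, of "t / c"] c by (simp add: add_divide_distrib)
  show "((\<lambda>t. K * c ^ Suc k * centred_psi (Suc k) a (t / c)) has_real_derivative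
      K * c ^ k * centred_psi k a ((t + (a + 2) * c / 2) / c)) (at t)" for t
  proof -
    have "((\<lambda>t. centred_psi (Suc k) a (t / c)) has_real_derivative
        centred_psi k a (t / c + (a + 2) / 2) * (1 / c)) (at t)"
      by (rule DERIV_chain2[OF centred_psi_derivative[OF a k]])
        (use c in \<open>auto intro!: derivative_eq_intros\<close>)
    from DERIV_cmult[OF this, of "K * c ^ Suc k"] show ?thesis unfolding half using c by (simp add: mult.assoc)
  qed
qed

lemma centred_psi_peak:
  assumes a: "a \<ge> 0" and k: "k \<ge> 2"
  shows "\<bar>centred_psi k a t\<bar> \<le> centred_psi k a 0" "centred_psi k a 0 > 0"
proof -
  interpret comparison_chain "\<lambda>k t. 1 * 1 ^ k * centred_psi k a (t / 1)" "(a + 2) * 1" 1 1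
    by (rule comparison_chain_psi) (use a in auto)
  show "\<bar>centred_psi k a t\<bar> \<le> centred_psi k a 0" using peak[of "k - 1" t] k by simp
  show "centred_psi k a 0 > 0" using pos[of "k - 1" 0] k a by simp
qed

text \<open>A Kolmogorov-type inequality. Here \<open>\<rho>\<close> is the least factor such that the spline dilated by \<open>\<rho>\<close>
dominates all the norms (it may be below \<open>1\<close>), so domination is attained with equality at some level \<open>j\<close>. If \<open>\<rho> > 1\<close>,
the strictness at level \<open>0\<close> propagates up to level \<open>j\<close> and contradicts this, unless \<open>j = n\<close>,
where strictness is immediate.\<close>

lemma intermediate_norms_le:
  assumes a: "a \<ge> 0" and c: "c > 0" and K: "K > 0"
    and X: "\<And>i t. i \<le> n \<Longrightarrow> (X i has_real_derivative X (Suc i) t) (at t)"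
    and lip: "\<And>s t. \<bar>X (Suc n) t - X (Suc n) s\<bar> \<le> K * \<bar>t - s\<bar>"
    and X0: "\<And>t. \<bar>X 0 t\<bar> \<le> K * c ^ (n + 2) * centred_psi (n + 2) a 0"
    and Xn: "\<And>t. \<bar>X n t\<bar> \<le> K * c\<^sup>2 * centred_psi 2 a 0"
    and i: "i \<le> n"
  shows "\<bar>X i t\<bar> \<le> K * c ^ (n + 2 - i) * centred_psi (n + 2 - i) a 0"
proof -
  define P where "P i = K * c ^ (n + 2 - i) * centred_psi (n + 2 - i) a 0" for i
  have P: "P i > 0" if "i \<le> n" for i
    unfolding P_def using that K c by (intro mult_pos_pos zero_less_power centred_psi_peak(2) a) auto
  define N where "N i = (SUP t. \<bar>X i t\<bar>)" for i
  have bdd: "bdd_above (range (\<lambda>t. \<bar>X i t\<bar>))" if "i \<le> n" for i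
  proof -
    have "\<exists>C. \<forall>t. \<bar>X i t\<bar> \<le> C"
      by (rule bounded_intermediate_derivatives[OF X X0 Xn that]) auto
    then show ?thesis by (auto intro: bdd_aboveI)
  qed
  have N_upper: "\<bar>X i t\<bar> \<le> N i" if "i \<le> n" for i t
    unfolding N_def by (rule cSUP_upper[OF _ bdd[OF that]]) simp
  have N_least: "N i \<le> C" if "\<And>t. \<bar>X i t\<bar> \<le> C" for i C
    unfolding N_def by (rule cSUP_least) (use that in auto)
  have N0: "N i \<ge> 0" if "i \<le> n" for i using N_upper[OF that, of 0] by linarith
  define \<mu> where "\<mu> i = root (n + 2 - i) (N i / P i)" for i
  have \<mu>0: "\<mu> i \<ge> 0" if "i \<le> n" for i
    unfolding \<mu>_def using N0 P that by (intro real_root_ge_zero divide_nonneg_pos) auto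
  have \<mu>_pow: "N i = \<mu> i ^ (n + 2 - i) * P i" if "i \<le> n" for i
  proof -
    have "\<mu> i ^ (n + 2 - i) = N i / P i"
      unfolding \<mu>_def using N0[OF that] P[OF that] that by (intro real_root_pow_pos2) auto
    then show ?thesis using P[OF that] by simp
  qed
  define \<rho> where "\<rho> = Max (\<mu> ` {0..n})"
  have \<mu>_le: "\<mu> i \<le> \<rho>" if "i \<le> n" for i unfolding \<rho>_def using that by (intro Max_ge) auto
  have N_le: "N i \<le> \<rho> ^ (n + 2 - i) * P i" if "i \<le> n" for i
    unfolding \<mu>_pow[OF that] using P[OF that] \<mu>0[OF that] \<mu>_le[OF that]
    by (intro mult_right_mono power_mono) auto
  have "\<rho> \<le> 1"
  proof (rule ccontr)
    assume "\<not> \<rho> \<le> 1"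
    then have \<rho>: "\<rho> > 1" by simp
    have grow: "P i < \<rho> ^ (n + 2 - i) * P i" if "i \<le> n" for i
      using P[OF that] \<rho> that by (simp add: one_less_power)
    interpret comparison_chain "\<lambda>k t. K * (\<rho> * c) ^ k * centred_psi k a (t / (\<rho> * c))"
        "(a + 2) * (\<rho> * c)" "\<rho> * c" K
      by (rule comparison_chain_psi) (use a c K \<rho> in auto)
    have PG: "K * (\<rho> * c) ^ (n + 2 - i) * centred_psi (n + 2 - i) a (0 / (\<rho> * c)) = \<rho> ^ (n + 2 - i) * P i" for i
      by (simp add: P_def power_mult_distrib)
    have bound: "\<bar>X i t\<bar> \<le> K * (\<rho> * c) ^ (n + 2 - i) * centred_psi (n + 2 - i) a (0 / (\<rho> * c))" if "i \<le> n" for i t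
      unfolding PG using N_upper[OF that, of t] N_le[OF that] by simp
    have m: "P 0 < K * (\<rho> * c) ^ (n + 2) * centred_psi (n + 2) a (0 / (\<rho> * c))"
      using grow[OF le0] PG[of 0] by (simp only: diff_zero)
    have m': "\<bar>X 0 t\<bar> \<le> P 0" for t using X0 by (simp add: P_def)
    have "\<mu> ` {0..n} \<noteq> {}" by simp
    then have "\<rho> \<in> \<mu> ` {0..n}" unfolding \<rho>_def by (intro Max_in) auto
    then obtain j where j: "j \<le> n" "\<rho> = \<mu> j" by auto
    have Nj: "N j = \<rho> ^ (n + 2 - j) * P j" using \<mu>_pow[OF j(1)] j by simp
    show False
    proof (cases "j = n")
      case True
      have "N j \<le> P j" using Xn True by (intro N_least) (simp add: P_def)
      then show False using Nj grow[OF j(1)] by simp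
    next
      case False
      then have "j < n" using j by simp
      from strict_bound_chain[OF X lip bound m m' this] obtain v where
        "v < \<rho> ^ (n + 2 - j) * P j" "\<And>t. \<bar>X j t\<bar> \<le> v" unfolding PG by blast
      then show False using N_least[of j v] Nj by simp
    qed
  qed
  moreover have "\<rho> \<ge> 0" using \<mu>0[of 0] \<mu>_le[of 0] by simp
  ultimately have "\<rho> ^ (n + 2 - i) * P i \<le> 1 * P i"
    using P[OF i] by (intro mult_right_mono power_le_one) auto
  then show ?thesis using N_upper[OF i, of t] N_le[OF i] by (simp add: P_def)
qed

section \<open>The norms of the splines and the comparison theorem\<close>

lemma psi1_differentiable:
  assumes a: "a \<ge> 0"
    and t: "\<And>m::int. t - (4 + 2*a) * of_int m \<notin> {0, 1, -1, a + 1, -(a + 1), a + 2, -(a + 2)}"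
  obtains d where "\<bar>d\<bar> \<le> 1" "(psi1 a has_real_derivative d) (at t)"
proof -
  obtain m where m: "\<bar>t - (4 + 2*a) * of_int m\<bar> \<le> a + 2"
    "psi1 a t = psi1_base a \<bar>t - (4 + 2*a) * of_int m\<bar>" by (rule psi1_eq_near[OF a])
  define p where "p = (4 + 2*a) * of_int m"
  define y where "y = t - p"
  have piece: "(psi1 a has_real_derivative d) (at t)"
    if y: "\<alpha> < y" "y < \<beta>" and \<alpha>\<beta>: "- (a + 2) \<le> \<alpha>" "\<beta> \<le> a + 2"
      and affine: "\<And>z. \<alpha> < z \<Longrightarrow> z < \<beta> \<Longrightarrow> psi1_base a \<bar>z\<bar> = d * z + e" for \<alpha> \<beta> d e
  proof (rule has_field_derivative_transform_within_open[of "\<lambda>s. d * (s - p) + e" d t "{p + \<alpha><..<p + \<beta>}"])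
    show "((\<lambda>s. d * (s - p) + e) has_real_derivative d) (at t)"
      by (auto intro!: derivative_eq_intros)
    show "t \<in> {p + \<alpha><..<p + \<beta>}" using y by (auto simp: y_def)
    fix s assume s: "s \<in> {p + \<alpha><..<p + \<beta>}"
    then have "\<bar>s - (4 + 2*a) * of_int m\<bar> \<le> a + 2" using \<alpha>\<beta> unfolding p_def[symmetric] by auto
    then have "psi1 a s = psi1_base a \<bar>s - p\<bar>" using psi1_eq_base[OF a] unfolding p_def by blast
    then show "d * (s - p) + e = psi1 a s" using affine[of "s - p"] s by auto
  qed simp
  have y: "y \<notin> {0, 1, -1, a + 1, -(a + 1), a + 2, -(a + 2)}" "\<bar>y\<bar> \<le> a + 2"
    using t[of m] m(1) by (auto simp: y_def p_def)
  then consider "- (a + 2) < y" "y < - (a + 1)" | "- (a + 1) < y" "y < - 1" | "- 1 < y" "y < 0"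
    | "0 < y" "y < 1" | "1 < y" "y < a + 1" | "a + 1 < y" "y < a + 2"
    by (auto simp: abs_le_iff) (linarith+)?
  then show thesis
  proof cases
    case 1 then show thesis using piece[of "- (a + 2)" "- (a + 1)" "- 1" "- (a + 1)"] a
      by (intro that[of "- 1"]) (auto simp: psi1_base_def)
  next
    case 2 then show thesis using piece[of "- (a + 1)" "- 1" 0 0] a
      by (intro that[of 0]) (auto simp: psi1_base_def)
  next
    case 3 then show thesis using piece[of "- 1" 0 "- 1" "- 1"] a
      by (intro that[of "- 1"]) (auto simp: psi1_base_def)
  next
    case 4 then show thesis using piece[of 0 1 1 "- 1"] a
      by (intro that[of 1]) (auto simp: psi1_base_def)
  next
    case 5 then show thesis using piece[of 1 "a + 1" 0 0] a
      by (intro that[of 0]) (auto simp: psi1_base_def)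
  next
    case 6 then show thesis using piece[of "a + 1" "a + 2" 1 "- (a + 1)"] a
      by (intro that[of 1]) (auto simp: psi1_base_def)
  qed
qed

lemma Psi_derivatives:
  assumes a: "a \<ge> 0" and s: "s < r"
  shows "(deriv ^^ s) (Psi r a b l) = (\<lambda>t. b * l ^ s * psi (r - s) a (l * t))"
  using s
proof (induction s)
  case 0
  show ?case by (simp add: Psi_def fun_eq_iff)
next
  case (Suc s)
  have e: "r - s = Suc (r - Suc s)" using Suc.prems by simp
  have "((\<lambda>t. b * l ^ s * psi (r - s) a (l * t)) has_real_derivative
      b * l ^ Suc s * psi (r - Suc s) a (l * t)) (at t)" for t
  proof -
    have "((\<lambda>t. psi (r - s) a (l * t)) has_real_derivative psi (r - Suc s) a (l * t) * l) (at t)"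
      unfolding e by (rule DERIV_chain2[OF psi_derivative[OF a]])
        (use Suc.prems in \<open>auto intro!: derivative_eq_intros\<close>)
    from DERIV_cmult[OF this, of "b * l ^ s"] show ?thesis by (simp add: algebra_simps)
  qed
  then have "deriv (\<lambda>t. b * l ^ s * psi (r - s) a (l * t)) = (\<lambda>t. b * l ^ Suc s * psi (r - Suc s) a (l * t))"
    by (intro ext DERIV_imp_deriv)
  then show ?case using Suc by simp
qed

lemma Linf_norm_Psi_derivative_le:
  assumes a: "a \<ge> 0" and bl: "b > 0" "l > 0" and s: "s + 2 \<le> r"
  shows "Linf_norm ((deriv ^^ s) (Psi r a b l)) \<le> ereal (b * l ^ s * centred_psi (r - s) a 0)"
proof (rule Linf_norm_le)
  have eq: "(deriv ^^ s) (Psi r a b l) = (\<lambda>t. b * l ^ s * psi (r - s) a (l * t))"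
    by (rule Psi_derivatives[OF a]) (use s in simp)
  have "continuous_on UNIV (\<lambda>t. b * l ^ s * psi (r - s) a (l * t))"
    by (intro continuous_intros continuous_on_compose2[OF psi_continuous[OF a]]) (use s in auto)
  then show "(deriv ^^ s) (Psi r a b l) \<in> borel_measurable lebesgue"
    unfolding eq by (intro measurable_completion) (simp add: borel_measurable_continuous_onI)
  have "\<bar>psi (r - s) a u\<bar> \<le> centred_psi (r - s) a 0" for u
    using centred_psi_peak(1)[OF a, of "r - s" "u - real (Suc (r - s)) * ((a + 2) / 2)"] s
    by (simp add: centred_psi_def)
  then have "\<bar>(deriv ^^ s) (Psi r a b l) t\<bar> \<le> b * l ^ s * centred_psi (r - s) a 0" for t
    unfolding eq using bl by (simp add: abs_mult)
  then show "AE t in lebesgue. \<bar>(deriv ^^ s) (Psi r a b l) t\<bar> \<le> b * l ^ s * centred_psi (r - s) a 0"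
    by simp
qed

lemma Linf_norm_Psi_top_derivative_le:
  assumes a: "a \<ge> 0" and bl: "b > 0" "l > 0" and r: "r \<ge> 1"
  shows "Linf_norm ((deriv ^^ r) (Psi r a b l)) \<le> ereal (b * l ^ r)"
proof (rule Linf_norm_le)
  define f where "f t = b * l ^ (r - 1) * psi1 a (l * t)" for t
  have "(deriv ^^ (r - 1)) (Psi r a b l) = f"
    using Psi_derivatives[OF a, of "r - 1" r b l] r psi_1 by (simp add: f_def[abs_def])
  moreover have "(deriv ^^ r) (Psi r a b l) = deriv ((deriv ^^ (r - 1)) (Psi r a b l))"
    using r by (cases r) auto
  ultimately have eq: "(deriv ^^ r) (Psi r a b l) = deriv f" by simp
  define Y where "Y = {0, 1, -1, a + 1, -(a + 1), a + 2, -(a + 2)}"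
  define C where "C = (\<lambda>(m::int, y). ((4 + 2*a) * of_int m + y) / l) ` (UNIV \<times> Y)"
  have C: "countable C" unfolding C_def
    by (intro countable_image countable_SIGMA) (auto simp: Y_def)
  have diff: "\<exists>d. \<bar>d\<bar> \<le> b * l ^ r \<and> (f has_real_derivative d) (at t)" if t: "t \<notin> C" for t
  proof -
    have "l * t - (4 + 2*a) * of_int m \<notin> Y" for m :: int
    proof
      assume y: "l * t - (4 + 2*a) * of_int m \<in> Y"
      have "t = ((4 + 2*a) * of_int m + (l * t - (4 + 2*a) * of_int m)) / l" using bl by simp
      then have "t \<in> C" unfolding C_def using y
        by (intro image_eqI[of _ _ "(m, l * t - (4 + 2*a) * of_int m)"]) auto
      then show False using t by simp
    qed
    then obtain d where d: "\<bar>d\<bar> \<le> 1" "(psi1 a has_real_derivative d) (at (l * t))"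
      unfolding Y_def by (rule psi1_differentiable[OF a])
    have "((\<lambda>t. psi1 a (l * t)) has_real_derivative d * l) (at t)"
      by (rule DERIV_chain2[where f = "psi1 a" and g = "\<lambda>t. l * t", OF d(2)]) (auto intro!: derivative_eq_intros)
    from DERIV_cmult[OF this, of "b * l ^ (r - 1)"]
    have A: "(f has_real_derivative b * l ^ (r - 1) * (d * l)) (at t)" by (simp add: f_def[abs_def])
    have B: "b * l ^ (r - 1) * (d * l) = b * l ^ r * d" using r by (cases r) (auto simp: algebra_simps)
    have "\<bar>b * l ^ r * d\<bar> \<le> b * l ^ r * 1"
      unfolding abs_mult using bl d by (intro mult_mono) auto
    then show ?thesis using A[unfolded B] by (intro exI[of _ "b * l ^ r * d"]) simp
  qed
  have "continuous_on UNIV f" unfolding f_def[abs_def]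
    by (intro continuous_intros continuous_on_compose2[OF psi1_continuous[OF a]]) auto
  then have "deriv f \<in> borel_measurable borel"
    by (rule borel_measurable_deriv[OF _ C]) (use diff field_differentiable_def in blast)
  then show "(deriv ^^ r) (Psi r a b l) \<in> borel_measurable lebesgue"
    unfolding eq by (intro measurable_completion) simp
  have "AE t in lebesgue. t \<notin> C"
    by (intro AE_not_in null_sets_completionI countable_imp_null_set_lborel C)
  then show "AE t in lebesgue. \<bar>(deriv ^^ r) (Psi r a b l) t\<bar> \<le> b * l ^ r"
  proof eventually_elim
    case (elim t)
    then obtain d where "\<bar>d\<bar> \<le> b * l ^ r" "(f has_real_derivative d) (at t)" using diff by blast
    then show ?case unfolding eq using DERIV_imp_deriv by fastforce
  qed
qed

theorem theorem2:
  fixes r :: nat and k2 :: int and x :: "real \<Rightarrow> real" and a b l \<tau> \<xi> :: real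
  assumes "0 < k2" and "k2 < int r - 2"
    and "x \<in> Lr_inf_inf r"
    and "a > 0" and "b > 0" and "l > 0"
    and "\<forall>s \<in> {0, r - 2, r}.
           Linf_norm ((deriv ^^ s) x) \<le> Linf_norm ((deriv ^^ s) (Psi r a b l))"
    and "x \<tau> = Psi r a b l \<xi>"
  shows "\<bar>deriv x \<tau>\<bar> \<le> \<bar>deriv (Psi r a b l) \<xi>\<bar>"
proof -
  (* The derivatives of x of the orders 0, ..., n are differentiable everywhere; order s
     corresponds to the index r - s of the chain. *)
  define n where "n = r - 2"
  have r: "r = n + 2" using assms(1,2) by (simp add: n_def)
  have a: "a \<ge> 0" using assms by simp
  define K where "K = b * l ^ r"
  define c where "c = 1 / l"
  have c: "c > 0" and K: "K > 0" using assms by (simp_all add: c_def K_def)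
  have cl: "K * c ^ (r - s) = b * l ^ s" if "s \<le> r" for s
    using \<open>l > 0\<close> that by (simp add: K_def c_def power_divide power_diff)
  define X where "X i = (deriv ^^ i) x" for i
  have x: "x \<in> Lr_inf r" using assms(3) by (simp add: Lr_inf_inf_def)
  have X: "(X i has_real_derivative X (Suc i) t) (at t)" if "i \<le> n" for i t
    using x that unfolding Lr_inf_def X_def
    by (auto simp: r DERIV_deriv_iff_field_differentiable)
  have XC: "continuous_on UNIV (X i)" if "i \<le> n" for i
    using X[OF that] by (intro DERIV_continuous_on) (auto intro: has_field_derivative_at_within)
  have bound: "\<bar>X s t\<bar> \<le> b * l ^ s * centred_psi (r - s) a 0" if s: "s \<in> {0, n}" for s t
  proof (rule AE_bound_continuous[OF XC AE_bound_if_Linf_norm_le])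
    show "s \<le> n" using s by auto
    have "Linf_norm (X s) \<le> Linf_norm ((deriv ^^ s) (Psi r a b l))"
      using assms(7) s unfolding X_def by (auto simp: r)
    also have "\<dots> \<le> ereal (b * l ^ s * centred_psi (r - s) a 0)"
      by (rule Linf_norm_Psi_derivative_le[OF a]) (use assms s r in auto)
    finally show "Linf_norm (X s) \<le> ereal (b * l ^ s * centred_psi (r - s) a 0)" .
  qed
  have lip: "\<bar>X (Suc n) t - X (Suc n) s\<bar> \<le> K * \<bar>t - s\<bar>" for s t
  proof (rule abs_continuous_lipschitz)
    show "locally_abs_continuous (X (Suc n))" using x by (simp add: Lr_inf_def X_def r)
    have "Linf_norm (deriv (X (Suc n))) \<le> Linf_norm ((deriv ^^ r) (Psi r a b l))"
      using assms(7) by (simp add: X_def r)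
    also have "\<dots> \<le> ereal K" unfolding K_def
      by (rule Linf_norm_Psi_top_derivative_le[OF a]) (use assms r in auto)
    finally show "AE t in lebesgue. \<bar>deriv (X (Suc n)) t\<bar> \<le> K" by (rule AE_bound_if_Linf_norm_le)
  qed
  have norms: "\<bar>X i t\<bar> \<le> K * c ^ (n + 2 - i) * centred_psi (n + 2 - i) a (0 / c)" if "i \<le> n" for i t
  proof -
    have "\<bar>X i t\<bar> \<le> K * c ^ (n + 2 - i) * centred_psi (n + 2 - i) a 0"
      by (rule intermediate_norms_le[OF a c K X lip _ _ that])
        (use bound[of 0] bound[of n] cl[of 0] cl[of n] in \<open>simp_all add: r\<close>)
    then show ?thesis by simp
  qed
  interpret comparison_chain "\<lambda>k t. K * c ^ k * centred_psi k a (t / c)" "(a + 2) * c" c K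
    by (rule comparison_chain_psi[OF a c K])
  have dom: "slope_dominated (n + 1) (X 0) (X 1)"
    using slope_dominated_chain[OF X lip norms, of 0] by simp
  (* The point of the centred spline that corresponds to \<xi>. *)
  define \<zeta> where "\<zeta> = \<xi> - c * (real (Suc r) * ((a + 2) / 2))"
  have \<zeta>: "\<zeta> / c + real (Suc r) * ((a + 2) / 2) = l * \<xi>"
    using c \<open>l > 0\<close> by (simp add: \<zeta>_def c_def field_simps)
  have "x \<tau> = K * c ^ Suc (n + 1) * centred_psi (Suc (n + 1)) a (\<zeta> / c)"
    using assms(8) \<zeta> cl[of 0] by (simp add: centred_psi_def Psi_def r)
  then have "\<bar>X 1 \<tau>\<bar> \<le> \<bar>K * c ^ (n + 1) * centred_psi (n + 1) a ((\<zeta> + (a + 2) * c / 2) / c)\<bar>"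
    using dom unfolding slope_dominated_def by (auto simp: X_def)
  moreover have "deriv (Psi r a b l) \<xi> = b * l * psi (n + 1) a (l * \<xi>)"
    using Psi_derivatives[OF a, of 1 r b l] by (simp add: r)
  moreover have "K * c ^ (n + 1) = b * l" using cl[of 1] by (simp add: r)
  moreover have "centred_psi (n + 1) a ((\<zeta> + (a + 2) * c / 2) / c) = psi (n + 1) a (l * \<xi>)"
  proof -
    have "(\<zeta> + (a + 2) * c / 2) / c + real (Suc (n + 1)) * ((a + 2) / 2) = l * \<xi>"
      using \<zeta> c by (simp add: r field_simps)
    then show ?thesis by (simp only: centred_psi_def)
  qed
  ultimately show ?thesis by (simp add: X_def)
qed

end
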